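(* Let $G$ be a $\sigma$-compact locally compact abelian group, $\mathcal{A}=(A_n)$ a Følner sequence in $G$, and $(X,G)$ a uniquely ergodic topological dynamical system with $X$ metrizable. Let $\mathbb{S}\subseteq\widehat{G}$ be the set of eigenvalues of $(X,G,m)$, where $m$ is the unique $G$-invariant probability measure on $X$. Let $K$ be a compact subset of $\widehat{G}\setminus\mathbb{S}$. Then, for all $f\in C(X)$, $$\lim_n\,\sup_{x\in X}\,\sup_{\chi\in K}\frac{1}{|A_n|}\left|\int_{A_n}f(t.x)\,\overline{\chi(t)}\,dt\right|=0.$$
   Context: $G$ is written additively, with a fixed Haar measure; $|A|$ is the Haar measure of $A\subseteq G$ and $dt$ denotes integration against it. $\widehat{G}$ is the dual group (continuous homomorphisms $G\to\{w\in\mathbb{C}:|w|=1\}$) with its usual locally compact topology. A Følner sequence is a sequence $(A_n)$ of open relatively compact subsets of $G$ (in particular $|A_n|>0$) with $\lim_n|A_n\triangle(t+A_n)|/|A_n|=0$ for all $t\in G$. A topological dynamical system $(X,G)$ is a compact space $X$ with a continuous action $G\times X\to X$, $(t,x)\mapsto t.x$. It is uniquely ergodic if it admits exactly one $G$-invariant Borel probability measure. $\chi\in\widehat{G}$ is an eigenvalue of $(X,G,m)$ if there is a nonzero $f\in L^2(X,m)$ with $f(t\,\cdot)=\chi(t)f$ in $L^2(X,m)$ for all $t\in G$. *)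

theory Defs
  imports "HOL-Probability.Probability"
begin

definition sigma_compact_lca :: "'g::{topological_ab_group_add, t2_space} itself \<Rightarrow> bool" where
  "sigma_compact_lca _ \<longleftrightarrow>
     locally_compact_space (euclidean :: 'g topology) \<and>
     (\<exists>C :: nat \<Rightarrow> 'g set. (\<forall>n. compact (C n)) \<and> (\<Union>n. C n) = UNIV)"

(* A nonzero translation invariant Radon measure.  The group need not be second countable,
   so regularity does not follow from finiteness on compact sets. *)
definition haar_measure :: "'g::{topological_ab_group_add, t2_space} measure \<Rightarrow> bool" where
  "haar_measure \<mu> \<longleftrightarrow>
     sets \<mu> = sets borel \<and>
     emeasure \<mu> UNIV \<noteq> 0 \<and>
     (\<forall>t. distr \<mu> borel ((+) t) = \<mu>) \<and>
     (\<forall>C. compact C \<longrightarrow> emeasure \<mu> C < \<infinity>) \<and>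
     (\<forall>B\<in>sets borel. emeasure \<mu> B = (INF U\<in>{U. open U \<and> B \<subseteq> U}. emeasure \<mu> U)) \<and>
     (\<forall>U. open U \<longrightarrow> emeasure \<mu> U = (SUP C\<in>{C. compact C \<and> C \<subseteq> U}. emeasure \<mu> C))"

definition folner_sequence ::
    "'g::{topological_ab_group_add, t2_space} measure \<Rightarrow> (nat \<Rightarrow> 'g set) \<Rightarrow> bool" where
  "folner_sequence \<mu> A \<longleftrightarrow>
     (\<forall>n. open (A n) \<and> compact (closure (A n)) \<and> 0 < measure \<mu> (A n)) \<and>
     (\<forall>t. (\<lambda>n. measure \<mu> (sym_diff (A n) ((+) t ` A n)) / measure \<mu> (A n)) \<longlonglongrightarrow> 0)"

definition dual_group :: "('g::{topological_ab_group_add, t2_space} \<Rightarrow> complex) set" where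
  "dual_group = {\<xi>. continuous_on UNIV \<xi> \<and> (\<forall>t. norm (\<xi> t) = 1) \<and>
                    (\<forall>s t. \<xi> (s + t) = \<xi> s * \<xi> t)}"

(* The compact-open topology, given by its standard subbase. *)
definition dual_topology :: "('g::{topological_ab_group_add, t2_space} \<Rightarrow> complex) topology" where
  "dual_topology = topology_generated_by
     {{\<xi> \<in> dual_group. \<xi> ` C \<subseteq> U} | C U. compact C \<and> open U}"

lemma topspace_dual_topology: "topspace dual_topology = dual_group"
proof -
  have "dual_group \<in> {{\<xi> \<in> dual_group. \<xi> ` C \<subseteq> U} | C U. compact C \<and> open (U :: complex set)}"
    by (rule CollectI, rule exI[of _ "{}"], rule exI[of _ UNIV]) auto
  then show ?thesis
    unfolding dual_topology_def topology_generated_by_topspace by auto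
qed

definition continuous_action ::
    "('g::{topological_ab_group_add, t2_space} \<Rightarrow> 'x::topological_space \<Rightarrow> 'x) \<Rightarrow> bool" where
  "continuous_action act \<longleftrightarrow>
     continuous_on UNIV (\<lambda>(t, x). act t x) \<and>
     (\<forall>x. act 0 x = x) \<and>
     (\<forall>s t x. act (s + t) x = act s (act t x))"

definition invariant_prob ::
    "('g \<Rightarrow> 'x::topological_space \<Rightarrow> 'x) \<Rightarrow> 'x measure \<Rightarrow> bool" where
  "invariant_prob act m \<longleftrightarrow>
     sets m = sets borel \<and> prob_space m \<and> (\<forall>t. distr m borel (act t) = m)"

definition uniquely_ergodic :: "('g \<Rightarrow> 'x::topological_space \<Rightarrow> 'x) \<Rightarrow> bool" where
  "uniquely_ergodic act \<longleftrightarrow> (\<exists>!m. invariant_prob act m)"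

(* Elements of L^2 are represented by square integrable functions; identities in L^2 hold
   almost everywhere, with an exceptional set that may depend on t. *)
definition eigenvalues ::
    "('g::{topological_ab_group_add, t2_space} \<Rightarrow> 'x::topological_space \<Rightarrow> 'x) \<Rightarrow> 'x measure
       \<Rightarrow> ('g \<Rightarrow> complex) set" where
  "eigenvalues act m = {\<xi> \<in> dual_group. \<exists>f :: 'x \<Rightarrow> complex.
     f \<in> borel_measurable m \<and> integrable m (\<lambda>x. (norm (f x))\<^sup>2) \<and>
     \<not> (AE x in m. f x = 0) \<and>
     (\<forall>t. AE x in m. f (act t x) = \<xi> t * f x)}"

end

theory Submission
  imports Defs
begin

text \<open>
  The theorem is a uniform version of the Wiener--Wintner theorem. Fix a character \<open>\<xi>\<close> that is
  not an eigenvalue and let the group act on \<open>L\<^sup>2(m)\<close> by the isometries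
  \<open>(V\<^sub>s g)(x) = cnj (\<xi> s) * g (s.x)\<close>. The closed convex hull of the orbit of \<open>f\<close> contains a
  unique element of least norm; it is fixed by every \<open>V\<^sub>s\<close>, so it would be an eigenfunction for \<open>\<xi>\<close>
  if it were not zero. Hence some finite convex combination \<open>F\<close> of translates \<open>V\<^sub>s f\<close> has small
  \<open>L\<^sup>2\<close> norm, and therefore small \<open>L\<^sup>1\<close> norm (\<open>small_twisted_average_if_not_eigenvalue\<close>).

  Finite combinations have three advantages over averages along the Folner sequence itself. First,
  \<open>F\<close> is again a continuous function, and no iterated integral over the group is needed. Secondly,
  by the Folner condition, \<open>f\<close> and \<open>F\<close> have asymptotically the same means
  over \<open>A n\<close> against \<open>cnj (\<xi> t)\<close> along every orbit, uniformly in \<open>x\<close> and in the character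
  (\<open>twisted_average_same_mean\<close>). Thirdly, \<open>F\<close> involves the values of the character at finitely many
  points only, so it changes little when \<open>\<xi>\<close> moves in a suitable neighbourhood
  (\<open>twisted_average_equicontinuous\<close>).

  The modulus of the mean of \<open>F\<close> is at most the mean of \<open>|F|\<close> over the orbit piece, which no longer
  involves the character. By unique ergodicity it is eventually at most \<open>\<integral>|F| dm + \<epsilon>\<close>, uniformly
  in \<open>x\<close> (\<open>uniquely_ergodic_averages_le\<close>). This gives the estimate near each point of \<open>K\<close>
  (\<open>locally_uniform_Wiener_Wintner\<close>), and compactness of \<open>K\<close> finishes the proof.

  The uniform bound from unique ergodicity uses that a sequence of orbit distributions has a weak
  limit, which is an invariant measure. Weak limits on \<open>X\<close> come from Helly's selection theorem on
  the real line: \<open>X\<close> is coded into the reals by an injective Borel map whose inverse extends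
  continuously to the closure of the image (\<open>compact_metrizable_real_coding\<close>). Measures are
  pushed to the line along the code, a convergent subsequence is taken there, and the limit is pulled
  back along the continuous inverse (\<open>borel_prob_weakly_seq_compact\<close>).
\<close>

section \<open>Coding a compact metrizable space by real numbers\<close>

text \<open>
  The type need not belong to the class of metric spaces, so the metric appears as a function \<open>d\<close> on the
  type, related to the given topology through its balls.
\<close>
lemma metrizable_euclidean_metric:
  assumes "metrizable_space (euclidean :: 'x::topological_space topology)"
  obtains d :: "'x::topological_space \<Rightarrow> 'x \<Rightarrow> real"
  where "Metric_space UNIV d"
    "\<And>U. open U \<longleftrightarrow> (\<forall>x\<in>U. \<exists>r>0. Metric_space.mball UNIV d x r \<subseteq> U)"
    "\<And>x r. open (Metric_space.mball UNIV d x r)"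
proof -
  obtain M d where md: "Metric_space M d" and top: "(euclidean :: 'x topology) = Metric_space.mtopology M d"
    using assms unfolding metrizable_space_def by blast
  interpret Metric_space M d by (rule md)
  have M: "M = (UNIV :: 'x set)"
    using topspace_mtopology top by (metis topspace_euclidean)
  have o: "open U \<longleftrightarrow> openin mtopology U" for U :: "'x set"
    using top open_openin by metis
  have "open U \<longleftrightarrow> (\<forall>x\<in>U. \<exists>r>0. mball x r \<subseteq> U)" for U :: "'x set"
    unfolding o openin_mtopology using M by auto
  moreover have "open (mball x r)" for x r
    unfolding o by simp
  ultimately show ?thesis using that md unfolding M by blast
qed

lemma compact_metrizable_countable_base:
  assumes "compact (UNIV :: 'x::topological_space set)"
    and "metrizable_space (euclidean :: 'x::topological_space topology)"
  obtains B :: "nat \<Rightarrow> 'x::topological_space set"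
  where "\<And>i. open (B i)" "\<And>U x. open U \<Longrightarrow> x \<in> U \<Longrightarrow> \<exists>i. x \<in> B i \<and> B i \<subseteq> U"
proof -
  obtain d where d: "Metric_space (UNIV :: 'x set) d"
    and op: "\<And>U. open U \<longleftrightarrow> (\<forall>x\<in>U. \<exists>r>0. Metric_space.mball UNIV d x r \<subseteq> U)"
    and opb: "\<And>x r. open (Metric_space.mball UNIV d x r)"
    using metrizable_euclidean_metric[OF assms(2)] by metis
  interpret Metric_space UNIV d by (rule d)
  have "\<exists>F. finite F \<and> UNIV \<subseteq> (\<Union>x\<in>F. mball x (1 / real (Suc n)))" for n
  proof -
    have "UNIV \<subseteq> (\<Union>x\<in>UNIV. mball x (1 / real (Suc n)))"
      by auto
    from compactE_image[OF assms(1) _ this] opb show ?thesis by (metis (no_types, lifting))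
  qed
  then obtain F where F: "\<And>n. finite (F n)"
      "\<And>n. UNIV \<subseteq> (\<Union>x\<in>F n. mball x (1 / real (Suc n)))" by metis
  define C where "C = (\<Union>n. (\<lambda>x. mball x (1 / real (Suc n))) ` F n)"
  have cC: "countable C" unfolding C_def using F(1) by (auto intro: countable_finite)
  have "F 0 \<noteq> {}"
  proof
    assume "F 0 = {}"
    then show False using F(2)[of 0] by simp
  qed
  then have "C \<noteq> {}" unfolding C_def by blast
  then have rg: "range (from_nat_into C) = C" using cC by (rule range_from_nat_into)
  have "\<exists>i. x \<in> from_nat_into C i \<and> from_nat_into C i \<subseteq> U" if U: "open U" "x \<in> U" for U x
  proof -
    obtain r where r: "r > 0" "mball x r \<subseteq> U" using U unfolding op[of U] by blast
    obtain n where n: "1 / real (Suc n) < r / 2" using r(1)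
      by (metis half_gt_zero inverse_eq_divide reals_Archimedean)
    obtain y where y: "y \<in> F n" "x \<in> mball y (1 / real (Suc n))"
      using subsetD[OF F(2)[of n] UNIV_I[of x]] by blast
    have "mball y (1 / real (Suc n)) \<subseteq> mball x r"
    proof
      fix z assume z: "z \<in> mball y (1 / real (Suc n))"
      have "d x z \<le> d x y + d y z" using triangle by auto
      also have "\<dots> < r" using z y n by (auto simp: commute)
      finally show "z \<in> mball x r" by auto
    qed
    then have sub: "mball y (1 / real (Suc n)) \<subseteq> U" using r(2) by (rule order_trans)
    have "mball y (1 / real (Suc n)) \<in> range (from_nat_into C)"
      unfolding rg unfolding C_def using y(1) by blast
    then obtain i where i: "from_nat_into C i = mball y (1 / real (Suc n))" by (metis imageE)
    show ?thesis by (rule exI[of _ i]) (use i sub y(2) in simp)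
  qed
  moreover have "open (from_nat_into C i)" for i
  proof -
    have "from_nat_into C i \<in> C" by (rule from_nat_into) fact
    moreover have "open c" if "c \<in> C" for c using that opb unfolding C_def by blast
    ultimately show ?thesis by blast
  qed
  ultimately show ?thesis using that by blast
qed

text \<open>
  The function is the distance to the complement, and the constant \<open>1\<close> if the complement is empty.
\<close>
lemma metrizable_open_eq_pos:
  assumes "metrizable_space (euclidean :: 'x::topological_space topology)" "open (U :: 'x::topological_space set)"
  obtains \<phi> :: "'x::topological_space \<Rightarrow> real"
  where "continuous_on UNIV \<phi>" "\<And>x. 0 \<le> \<phi> x" "\<And>x. \<phi> x > 0 \<longleftrightarrow> x \<in> U"
proof (cases "U = UNIV")
  case True
  then show ?thesis by (intro that[of "\<lambda>_. 1"]) auto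
next
  case False
  obtain d where d: "Metric_space (UNIV :: 'x set) d"
    and op: "\<And>U. open U \<longleftrightarrow> (\<forall>x\<in>U. \<exists>r>0. Metric_space.mball UNIV d x r \<subseteq> U)"
    and opb: "\<And>x r. open (Metric_space.mball UNIV d x r)"
    using metrizable_euclidean_metric[OF assms(1)] by metis
  interpret Metric_space UNIV d by (rule d)
  define \<phi> where "\<phi> x = (INF y\<in>-U. d x y)" for x
  have bb: "bdd_below (d x ` (-U))" for x by (auto intro!: bdd_belowI2[of _ 0])
  have ne: "-U \<noteq> {}" using False by auto
  have nonneg: "0 \<le> \<phi> x" for x unfolding \<phi>_def by (intro cINF_greatest ne) auto
  have lip: "\<phi> x \<le> \<phi> y + d x y" for x y
  proof -
    have "\<phi> x - d x y \<le> d y z" if "z \<in> -U" for z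
    proof -
      have "\<phi> x \<le> d x z" unfolding \<phi>_def by (rule cINF_lower[OF bb that])
      also have "\<dots> \<le> d x y + d y z" using triangle by auto
      finally show ?thesis by simp
    qed
    then have "\<phi> x - d x y \<le> \<phi> y" unfolding \<phi>_def[of y] by (intro cINF_greatest ne)
    then show ?thesis by simp
  qed
  have cont: "continuous_on UNIV \<phi>"
    unfolding continuous_on_topological
  proof (intro ballI allI impI)
    fix x and V :: "real set" assume V: "open V" "\<phi> x \<in> V"
    then obtain e where e: "e > 0" "\<And>r. dist r (\<phi> x) < e \<Longrightarrow> r \<in> V"
      by (metis open_dist)
    have "\<phi> y \<in> V" if "y \<in> mball x e" for y
      using lip[of x y] lip[of y x] that by (intro e(2)) (auto simp: dist_real_def commute)
    then show "\<exists>A. open A \<and> x \<in> A \<and> (\<forall>y\<in>UNIV. y \<in> A \<longrightarrow> \<phi> y \<in> V)"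
      using e(1) by (intro exI[of _ "mball x e"]) (auto simp: opb)
  qed
  have "\<phi> x > 0" if x: "x \<in> U" for x
  proof -
    obtain r where r: "r > 0" "mball x r \<subseteq> U" using x assms(2) unfolding op[of U] by blast
    have "r \<le> \<phi> x" unfolding \<phi>_def
      using r by (intro cINF_greatest ne) (force simp: not_less[symmetric])
    then show ?thesis using r by simp
  qed
  moreover have "\<phi> x = 0" if "x \<notin> U" for x
    using cINF_lower[OF bb, of x x] that nonneg[of x] unfolding \<phi>_def by (auto simp: mdist_zero)
  ultimately show ?thesis by (intro that[OF cont nonneg]) (metis less_irrefl)
qed

text \<open>
  At the first index \<open>i\<close> where the digits differ, the sums differ by at least
  \<open>(1/3)^i - (\<Sum>j>i. (1/3)^j) = (1/3)^i / 2\<close>. Base three with digits \<open>0\<close> and \<open>1\<close> makes nearby sums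
  agree in their leading digits, which fails in base two.
\<close>
lemma ternary_digits_eq:
  fixes a b :: "nat \<Rightarrow> bool"
  assumes "\<bar>(\<Sum>i. of_bool (a i) * (1/3)^i) - (\<Sum>i. of_bool (b i) * (1/3)^i)\<bar> < ((1/3)^n / 2 :: real)"
    and "i \<le> n"
  shows "a i = b i"
  using assms(2)
proof (induction i rule: less_induct)
  case (less i)
  define d :: "nat \<Rightarrow> real" where "d j = (of_bool (a j) - of_bool (b j)) * (1/3)^j" for j
  have db: "\<bar>d j\<bar> \<le> (1/3)^j" for j by (auto simp: d_def)
  have sm: "summable (\<lambda>j. of_bool (c j) * (1/3)^j :: real)" for c :: "nat \<Rightarrow> bool"
    by (rule summable_comparison_test'[of "\<lambda>j. (1/3)^j"]) (auto simp: summable_geometric)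
  have sd: "summable d"
    by (rule summable_comparison_test'[of "\<lambda>j. (1/3)^j"]) (use db in \<open>auto simp: summable_geometric\<close>)
  have sgi: "summable (\<lambda>j. (1/3)^(j + Suc i) :: real)"
    by (subst summable_iff_shift) (auto simp: summable_geometric)
  have diff: "suminf d = (\<Sum>i. of_bool (a i) * (1/3)^i) - (\<Sum>i. of_bool (b i) * (1/3)^i)"
    unfolding suminf_diff[OF sm sm] d_def by (simp add: left_diff_distrib)
  have "d j = 0" if "j < i" for j
    using less that unfolding d_def by simp
  then have "suminf d = (\<Sum>j. d (j + Suc i)) + d i"
    using suminf_split_initial_segment[OF sd, of "Suc i"] by simp
  moreover have "\<bar>\<Sum>j. d (j + Suc i)\<bar> \<le> (\<Sum>j. (1/3)^(j + Suc i))"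
  proof -
    have "summable (\<lambda>j. \<bar>d (j + Suc i)\<bar>)"
      by (rule summable_comparison_test'[OF sgi, of 0]) (metis abs_abs db real_norm_def)
    then show ?thesis
      by (intro order_trans[OF summable_rabs] suminf_le sgi db)
  qed
  moreover have "(\<Sum>j. (1/3)^(j + Suc i)) = ((1/3)^i / 2 :: real)"
  proof -
    have "(\<Sum>j. (1/3)^(j + Suc i)) = (\<Sum>j. (1/3)^Suc i * (1/3)^j :: real)"
      by (simp add: power_add mult_ac)
    also have "\<dots> = (1/3)^Suc i * (\<Sum>j. (1/3)^j)" by (rule suminf_mult) (simp add: summable_geometric)
    also have "\<dots> = (1/3)^i / 2" by (simp add: suminf_geometric)
    finally show ?thesis .
  qed
  moreover have "\<bar>suminf d\<bar> < (1/3)^n / 2" using assms(1) diff by simp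
  moreover have "(1/3)^n \<le> ((1/3)^i :: real)" using less.prems by (intro power_decreasing) auto
  ultimately have "\<bar>d i\<bar> < (1/3)^i" by linarith
  then show ?case unfolding d_def by (auto split: if_splits simp: abs_mult)
qed

text \<open>
  The code of a point lists in base three which sets of a countable base contain it. It is only a
  Borel map, but points with nearby codes lie in the same basic sets up to a large index. Hence a
  limit \<open>b\<close> of codes determines a single point of \<open>X\<close>, which exists by compactness, and this point
  depends continuously on \<open>b\<close>.
\<close>
lemma compact_metrizable_real_coding:
  assumes "compact (UNIV :: 'x::topological_space set)"
    and metr: "metrizable_space (euclidean :: 'x::topological_space topology)"
  obtains s :: "'x::topological_space \<Rightarrow> real" and p :: "real \<Rightarrow> 'x"
  where "s \<in> borel_measurable borel" "\<And>x. \<bar>s x\<bar> \<le> 2" "\<And>x. p (s x) = x"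
    "continuous_on (closure (range s)) p"
proof -
  obtain B :: "nat \<Rightarrow> 'x set" where B: "\<And>i. open (B i)"
      "\<And>U x. open U \<Longrightarrow> x \<in> U \<Longrightarrow> \<exists>i. x \<in> B i \<and> B i \<subseteq> U"
    using compact_metrizable_countable_base[OF assms] by blast
  define s :: "'x \<Rightarrow> real" where "s x = (\<Sum>i. of_bool (x \<in> B i) * (1/3)^i)" for x
  have smeas: "s \<in> borel_measurable borel"
  proof -
    have [measurable]: "B i \<in> sets borel" for i using B(1) by simp
    show ?thesis unfolding s_def by measurable
  qed
  have sm: "summable (\<lambda>j. of_bool (c j) * (1/3)^j :: real)" for c :: "nat \<Rightarrow> bool"
    by (rule summable_comparison_test'[of "\<lambda>j. (1/3)^j"]) (auto simp: summable_geometric)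
  have sbd: "\<bar>s x\<bar> \<le> 2" for x
  proof -
    have "0 \<le> s x" unfolding s_def by (intro suminf_nonneg sm) auto
    moreover have "s x \<le> (\<Sum>i. (1/3)^i)"
      unfolding s_def by (intro suminf_le sm) (auto simp: summable_geometric)
    ultimately show ?thesis by (simp add: suminf_geometric)
  qed
  have digit: "x \<in> B i \<longleftrightarrow> y \<in> B i" if "\<bar>s x - s y\<bar> < (1/3)^i / 2" for x y i
    using ternary_digits_eq[of "\<lambda>i. x \<in> B i" "\<lambda>i. y \<in> B i" i i] that unfolding s_def by auto
  have haus: "Hausdorff_space (euclidean :: 'x::topological_space topology)"
    using metr by (rule metrizable_imp_Hausdorff_space)
  have reg: "regular_space (euclidean :: 'x::topological_space topology)"
    using metr by (rule metrizable_imp_regular_space)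
  have shrink: "\<exists>V. open V \<and> x \<in> V \<and> closure V \<subseteq> U" if "open U" "x \<in> U" for U and x :: 'x
  proof -
    have "\<exists>V W. open V \<and> closed W \<and> x \<in> V \<and> V \<subseteq> W \<and> W \<subseteq> U"
      using reg that unfolding neighbourhood_base_of_closedin[symmetric] neighbourhood_base_of
      by (metis closed_closedin open_openin)
    then show ?thesis by (meson closure_minimal order_trans)
  qed
  \<comment> \<open>The point coded by \<open>b\<close> is the common point of the sets \<open>C b r\<close>, \<open>r > 0\<close>.
    Closures are needed for limits of codes that are not themselves codes.\<close>
  define C where "C b r = closure {x. \<bar>s x - b\<bar> < r}" for b r
  have Cmono: "C b r \<subseteq> C b r'" if "r \<le> r'" for b r r'
    unfolding C_def using that by (intro closure_mono) auto
  have Cuniq: "x = y" if x: "\<And>r. r > 0 \<Longrightarrow> x \<in> C b r" and y: "\<And>r. r > 0 \<Longrightarrow> y \<in> C b r" for b x y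
  proof (rule ccontr)
    assume "x \<noteq> y"
    then obtain U where U: "open U" "x \<in> U" "y \<notin> U"
      using Hausdorff_imp_t1_space[OF haus] unfolding t1_space_def by (metis UNIV_I open_openin topspace_euclidean)
    obtain V where V: "open V" "x \<in> V" "closure V \<subseteq> U" using shrink U by blast
    obtain i where i: "x \<in> B i" "B i \<subseteq> V" using B(2) V by blast
    \<comment> \<open>Codes within \<open>r\<close> of \<open>b\<close> are closer than \<open>(1/3)^i / 2\<close> to each other,
      so they have the same digit \<open>i\<close>.\<close>
    define r :: real where "r = (1/3)^i / 4"
    have r: "r > 0" unfolding r_def by simp
    obtain z where z: "z \<in> B i" "\<bar>s z - b\<bar> < r"
      using x[OF r] i(1) B(1) unfolding C_def closure_iff_nhds_not_empty by blast
    have "{w. \<bar>s w - b\<bar> < r} \<subseteq> B i"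
    proof
      fix w assume "w \<in> {w. \<bar>s w - b\<bar> < r}"
      then have "\<bar>s w - b\<bar> < r" by simp
      then have "\<bar>s z - s w\<bar> < (1/3)^i / 2" using z(2) unfolding r_def by linarith
      then show "w \<in> B i" using digit[of z w i] z(1) by blast
    qed
    then have "C b r \<subseteq> closure V" unfolding C_def using i(2) by (intro closure_mono) auto
    then show False using y[OF r] V U by blast
  qed
  have Cex: "\<exists>x. \<forall>r>0. x \<in> C b r" if b: "b \<in> closure (range s)" for b
  proof -
    have "UNIV \<inter> (\<Inter>r\<in>{0<..}. C b r) \<noteq> {}"
    proof (rule compact_imp_fip_image[OF assms(1)])
      show "closed (C b r)" for r unfolding C_def by simp
      fix I assume I: "finite I" "I \<subseteq> {0::real<..}"
      have "\<exists>r>0. \<forall>i\<in>I. r \<le> i"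
        by (rule exI[of _ "Min (insert 1 I)"]) (use I in auto)
      then obtain r where r: "r > 0" "\<And>i. i \<in> I \<Longrightarrow> r \<le> i" by blast
      obtain x where "\<bar>s x - b\<bar> < r"
        using b r(1) unfolding closure_approachable dist_real_def by blast
      then have "x \<in> C b r" unfolding C_def by (meson closure_subset mem_Collect_eq subsetD)
      then have "x \<in> UNIV \<inter> (\<Inter>i\<in>I. C b i)" using Cmono r(2) by blast
      then show "UNIV \<inter> (\<Inter>i\<in>I. C b i) \<noteq> {}" by blast
    qed
    then show ?thesis by auto
  qed
  define p where "p b = (SOME x. \<forall>r>0. x \<in> C b r)" for b
  have pC: "p b \<in> C b r" if "b \<in> closure (range s)" "r > 0" for b r
    using someI_ex[OF Cex[OF that(1)]] that(2) unfolding p_def by blast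
  have ps: "p (s x) = x" for x
  proof (rule Cuniq)
    show "p (s x) \<in> C (s x) r" if "r > 0" for r using that
      by (intro pC) (auto intro: subsetD[OF closure_subset])
    show "x \<in> C (s x) r" if "r > 0" for r
      using that unfolding C_def by (intro subsetD[OF closure_subset]) auto
  qed
  have "continuous_on (closure (range s)) p"
    unfolding continuous_on_topological
  proof (intro ballI allI impI)
    fix b and U :: "'x set" assume b: "b \<in> closure (range s)" and U: "open U" "p b \<in> U"
    \<comment> \<open>The sets \<open>C b r\<close> are compact, decrease with \<open>r\<close> and meet only in \<open>p b\<close>.\<close>
    have "\<exists>r>0. C b r \<subseteq> U"
    proof (rule ccontr)
      assume no: "\<not> (\<exists>r>0. C b r \<subseteq> U)"
      have "(-U) \<inter> (\<Inter>r\<in>{0<..}. C b r) \<noteq> {}"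
      proof (rule compact_imp_fip_image)
        show "compact (-U)" using U assms(1) by (metis Compl_eq_Diff_UNIV compact_diff)
        show "closed (C b r)" for r unfolding C_def by simp
        fix I assume I: "finite I" "I \<subseteq> {0::real<..}"
        have "\<exists>r>0. \<forall>i\<in>I. r \<le> i"
          by (rule exI[of _ "Min (insert 1 I)"]) (use I in auto)
        then obtain r where r: "r > 0" "\<And>i. i \<in> I \<Longrightarrow> r \<le> i" by blast
        then show "(-U) \<inter> (\<Inter>i\<in>I. C b i) \<noteq> {}" using no Cmono by blast
      qed
      then obtain y where y: "y \<notin> U" "\<And>r. r > 0 \<Longrightarrow> y \<in> C b r" by auto
      then have "y = p b" using Cuniq pC[OF b] by blast
      then show False using y U by blast
    qed
    then obtain r where r: "r > 0" "C b r \<subseteq> U" by blast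
    have "p b' \<in> U" if b': "b' \<in> closure (range s)" "b' \<in> ball b (r/2)" for b'
    proof -
      have "C b' (r/2) \<subseteq> C b r" unfolding C_def
      proof (intro closure_mono subsetI)
        fix x assume "x \<in> {x. \<bar>s x - b'\<bar> < r / 2}"
        then show "x \<in> {x. \<bar>s x - b\<bar> < r}" using b'(2)
          unfolding mem_ball dist_real_def mem_Collect_eq by linarith
      qed
      then show ?thesis using pC[OF b'(1), of "r/2"] r by auto
    qed
    then show "\<exists>A. open A \<and> b \<in> A \<and> (\<forall>y\<in>closure (range s). y \<in> A \<longrightarrow> p y \<in> U)"
      using r(1) by (intro exI[of _ "ball b (r/2)"]) auto
  qed
  then show ?thesis using that smeas sbd ps by blast
qed

section \<open>Weak sequential compactness of Borel probability measures\<close>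

lemma compact_continuous_bounded:
  fixes \<phi> :: "'x::topological_space \<Rightarrow> 'b::real_normed_vector"
  assumes "compact (UNIV :: 'x set)" "continuous_on UNIV \<phi>"
  obtains b where "b > 0" "\<And>x. norm (\<phi> x) \<le> b"
  using compact_imp_bounded[OF compact_continuous_image[OF assms(2,1)]]
  unfolding bounded_pos by auto

text \<open>
  On an open set \<open>U = {\<phi> > 0}\<close> the functions \<open>min 1 (k * \<phi>)\<close> increase to the indicator of \<open>U\<close>,
  and the open sets form a generator that is stable under intersection.
\<close>
lemma borel_prob_eqI_continuous:
  fixes M N :: "'x::topological_space measure"
  assumes metr: "metrizable_space (euclidean :: 'x topology)"
    and "prob_space M" "prob_space N" and [measurable_cong]: "sets M = sets borel" "sets N = sets borel"
    and eq: "\<And>\<phi> :: 'x \<Rightarrow> real. continuous_on UNIV \<phi> \<Longrightarrow> integral\<^sup>L M \<phi> = integral\<^sup>L N \<phi>"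
  shows "M = N"
proof (rule measure_eqI_generator_eq[where E = "{U. open U}" and \<Omega> = UNIV and A = "\<lambda>_. UNIV"])
  interpret M: prob_space M by fact
  interpret N: prob_space N by fact
  show "Int_stable {U :: 'x set. open U}" by (auto intro!: Int_stableI)
  show "sets M = sigma_sets UNIV {U. open U}" "sets N = sigma_sets UNIV {U. open U}"
    by (simp_all add: assms(4,5) borel_def)
  fix U :: "'x set" assume "U \<in> {U. open U}"
  then have U: "open U" by simp
  then have [measurable]: "U \<in> sets borel" by simp
  obtain \<phi> :: "'x \<Rightarrow> real" where \<phi>: "continuous_on UNIV \<phi>" "\<And>x. 0 \<le> \<phi> x" "\<And>x. \<phi> x > 0 \<longleftrightarrow> x \<in> U"
    using metrizable_open_eq_pos[OF metr U] by metis
  have cont: "continuous_on UNIV (\<lambda>x. min 1 (real k * \<phi> x))" for k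
    using \<phi>(1) by (intro continuous_intros)
  have [measurable]: "(\<lambda>x. min 1 (real k * \<phi> x)) \<in> borel_measurable borel" for k
    using cont by (rule borel_measurable_continuous_onI)
  have lim: "(\<lambda>k. min 1 (real k * \<phi> x)) \<longlonglongrightarrow> indicator U x" for x
  proof (cases "x \<in> U")
    case True
    then have "\<phi> x > 0" using \<phi>(3) by simp
    then obtain k0 where k0: "1 < real k0 * \<phi> x" using reals_Archimedean3 by blast
    have "min 1 (real k * \<phi> x) = 1" if "k \<ge> k0" for k
    proof -
      have "real k0 * \<phi> x \<le> real k * \<phi> x" using that \<phi>(2) by (intro mult_right_mono) auto
      then show ?thesis using k0 by linarith
    qed
    then have "eventually (\<lambda>k. min 1 (real k * \<phi> x) = 1) sequentially"
      by (auto simp: eventually_sequentially)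
    then show ?thesis using True by (simp add: tendsto_eventually)
  next
    case False
    then have "\<phi> x = 0" using \<phi>(2)[of x] \<phi>(3)[of x] by linarith
    then show ?thesis using False by simp
  qed
  have tend: "(\<lambda>k. integral\<^sup>L L (\<lambda>x. min 1 (real k * \<phi> x))) \<longlonglongrightarrow> measure L U"
    if "prob_space L" and [measurable_cong]: "sets L = sets borel" for L
  proof -
    interpret prob_space L by fact
    have "(\<lambda>k. integral\<^sup>L L (\<lambda>x. min 1 (real k * \<phi> x))) \<longlonglongrightarrow> integral\<^sup>L L (indicator U)"
      by (rule integral_dominated_convergence[where w = "\<lambda>_. 1"])
        (use lim \<phi>(2) in \<open>auto intro!: AE_I2\<close>)
    then show ?thesis by simp
  qed
  have "measure M U = measure N U"
    using LIMSEQ_unique[OF tend[OF assms(2,4)]] tend[OF assms(3,5)] eq[OF cont] by simp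
  then show "emeasure M U = emeasure N U"
    by (simp add: M.emeasure_eq_measure N.emeasure_eq_measure)
qed (use prob_space.emeasure_space_1[OF assms(2)] sets_eq_imp_space_eq[OF assms(4)] in auto)

text \<open>
  The images \<open>\<rho>\<close> of the measures under the code live on a bounded part of the line, so Helly's theorem
  gives a weakly convergent subsequence. Its limit is carried by the closure \<open>S\<close> of the set of codes, where the
  decoding map is continuous. For continuous \<open>\<phi>\<close> the function \<open>\<phi> \<circ> p\<close> on \<open>S\<close> extends to a bounded continuous
  function on the line by Tietze's theorem, and integrals of that extension converge.
\<close>
lemma borel_prob_weakly_seq_compact:
  fixes \<nu> :: "nat \<Rightarrow> 'x::topological_space measure"
  assumes comp: "compact (UNIV :: 'x set)" and metr: "metrizable_space (euclidean :: 'x topology)"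
    and prob: "\<And>k. prob_space (\<nu> k)" and sets: "\<And>k. sets (\<nu> k) = sets borel"
  obtains r \<nu>' where "strict_mono (r :: nat \<Rightarrow> nat)" "prob_space \<nu>'" "sets \<nu>' = sets borel"
    "\<And>\<phi> :: 'x \<Rightarrow> real. continuous_on UNIV \<phi> \<Longrightarrow>
       (\<lambda>k. integral\<^sup>L (\<nu> (r k)) \<phi>) \<longlonglongrightarrow> integral\<^sup>L \<nu>' \<phi>"
proof -
  obtain s :: "'x \<Rightarrow> real" and p :: "real \<Rightarrow> 'x"
    where s[measurable]: "s \<in> borel_measurable borel" and sb: "\<And>x. \<bar>s x\<bar> \<le> 2" and ps: "\<And>x. p (s x) = x"
      and pc: "continuous_on (closure (range s)) p"
    using compact_metrizable_real_coding[OF comp metr] by metis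
  note sets[measurable_cong]
  define S where "S = closure (range s)"
  have S: "closed S" "S \<noteq> {}" "s x \<in> S" for x
    unfolding S_def using closure_subset[of "range s"] by auto
  define \<rho> where "\<rho> k = distr (\<nu> k) borel s" for k
  have rd: "real_distribution (\<rho> k)" for k
    unfolding \<rho>_def by (intro prob_space.real_distribution_distr prob) measurable
  have "measure (\<rho> k) {-3<..2} = 1" for k
  proof -
    have "s -` {-3<..2} \<inter> space (\<nu> k) = space (\<nu> k)"
    proof -
      have "-3 < s x \<and> s x \<le> 2" for x using sb[of x] by linarith
      then show ?thesis by auto
    qed
    then show ?thesis unfolding \<rho>_def
      by (subst measure_distr) (auto simp: prob_space.prob_space[OF prob])
  qed
  then have "\<exists>a b. a < b \<and> (\<forall>k. 1 - \<epsilon> < measure (\<rho> k) {a<..b})" if "\<epsilon> > 0" for \<epsilon> :: real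
    using that by (intro exI[of _ "-3"] exI[of _ 2]) simp
  then have "tight \<rho>" unfolding tight_def using rd by blast
  then obtain r M where r: "strict_mono (r :: nat \<Rightarrow> nat)" and M: "real_distribution M"
      and wc: "weak_conv_m (\<rho> \<circ> id \<circ> r) M"
    using tight_imp_convergent_subsubsequence[of \<rho> id] by (auto simp: strict_mono_id)
  interpret M: real_distribution M by fact
  have conv: "(\<lambda>k. integral\<^sup>L (\<rho> (r k)) \<psi>) \<longlonglongrightarrow> integral\<^sup>L M \<psi>"
    if "continuous_on UNIV \<psi>" "\<And>x. norm (\<psi> x) \<le> b" for \<psi> :: "real \<Rightarrow> real" and b
    using weak_conv_imp_integral_bdd_continuous_conv[OF _ M wc, of \<psi> b] rd that
    by (simp add: o_def continuous_on_eq_continuous_at)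
  \<comment> \<open>The truncated distance to \<open>S\<close> integrates to zero against every \<open>\<rho> k\<close>, hence against \<open>M\<close>.\<close>
  have "AE b in M. b \<in> S"
  proof -
    define \<psi> where "\<psi> b = min 1 (infdist b S)" for b
    have c: "continuous_on UNIV \<psi>" unfolding \<psi>_def by (intro continuous_intros)
    then have [measurable]: "\<psi> \<in> borel_measurable borel" by (rule borel_measurable_continuous_onI)
    have bd: "norm (\<psi> b) \<le> 1" "0 \<le> \<psi> b" for b unfolding \<psi>_def by (auto simp: infdist_nonneg)
    have "integral\<^sup>L (\<rho> k) \<psi> = 0" for k
    proof -
      have "integral\<^sup>L (\<rho> k) \<psi> = integral\<^sup>L (\<nu> k) (\<lambda>x. \<psi> (s x))"
        unfolding \<rho>_def by (rule integral_distr) measurable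
      then show ?thesis using S(3) by (simp add: \<psi>_def)
    qed
    then have "integral\<^sup>L M \<psi> = 0"
      using LIMSEQ_unique[OF conv[OF c bd(1)]] by simp
    moreover have "integrable M \<psi>" by (rule M.integrable_const_bound[where B = 1]) (use bd in auto)
    ultimately have "AE b in M. \<psi> b = 0"
      using integral_nonneg_eq_0_iff_AE bd(2) by blast
    then show ?thesis
    proof eventually_elim
      case (elim b)
      then have "infdist b S = 0" unfolding \<psi>_def by linarith
      then show ?case using S in_closed_iff_infdist_zero by blast
    qed
  qed
  \<comment> \<open>The value \<open>p 0\<close> off the null set \<open>- S\<close> only serves to make \<open>q\<close> Borel on the whole line.\<close>
  define q where "q b = (if b \<in> S then p b else p 0)" for b
  have [measurable]: "q \<in> borel_measurable borel"
    unfolding q_def using S(1) pc unfolding S_def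
    by (intro borel_measurable_continuous_on_if) auto
  define \<nu>' where "\<nu>' = distr M borel q"
  have lim: "(\<lambda>k. integral\<^sup>L (\<nu> (r k)) \<phi>) \<longlonglongrightarrow> integral\<^sup>L \<nu>' \<phi>"
    if \<phi>: "continuous_on UNIV \<phi>" for \<phi> :: "'x \<Rightarrow> real"
  proof -
    have [measurable]: "\<phi> \<in> borel_measurable borel" using \<phi> by (rule borel_measurable_continuous_onI)
    obtain b where b: "b > 0" "\<And>x. norm (\<phi> x) \<le> b" using compact_continuous_bounded[OF comp \<phi>] by blast
    have "continuous_on S (\<lambda>x. \<phi> (p x))"
      using continuous_on_compose2[OF \<phi> pc] unfolding S_def by auto
    then obtain \<psi> where \<psi>: "continuous_on UNIV \<psi>" "\<And>x. x \<in> S \<Longrightarrow> \<psi> x = \<phi> (p x)" "\<And>x. norm (\<psi> x) \<le> b"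
      using Tietze[of S "\<lambda>x. \<phi> (p x)" UNIV b] S(1) b by (auto simp: less_imp_le)
    have [measurable]: "\<psi> \<in> borel_measurable borel" using \<psi>(1) by (rule borel_measurable_continuous_onI)
    have "integral\<^sup>L (\<rho> k) \<psi> = integral\<^sup>L (\<nu> k) \<phi>" for k
    proof -
      have "integral\<^sup>L (\<rho> k) \<psi> = integral\<^sup>L (\<nu> k) (\<lambda>x. \<psi> (s x))"
        unfolding \<rho>_def by (rule integral_distr) measurable
      then show ?thesis using S(3) \<psi>(2) ps by simp
    qed
    moreover have "integral\<^sup>L M \<psi> = integral\<^sup>L \<nu>' \<phi>"
    proof -
      have "integral\<^sup>L \<nu>' \<phi> = integral\<^sup>L M (\<lambda>x. \<phi> (q x))"
        unfolding \<nu>'_def by (rule integral_distr) measurable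
      also have "\<dots> = integral\<^sup>L M \<psi>"
        by (rule integral_cong_AE; measurable?) (use \<open>AE b in M. b \<in> S\<close> in \<open>auto simp: q_def \<psi>(2)\<close>)
      finally show ?thesis by simp
    qed
    ultimately show ?thesis using conv[OF \<psi>(1,3)] by simp
  qed
  have "prob_space \<nu>'" unfolding \<nu>'_def by (rule M.prob_space_distr) measurable
  then show ?thesis using that[OF r _ _ lim] by (simp add: \<nu>'_def)
qed

section \<open>Means along orbits and unique ergodicity\<close>

lemma haar_measure_translate:
  fixes \<mu> :: "'g::{topological_ab_group_add, t2_space} measure"
  assumes haar: "haar_measure \<mu>" and A: "open A" "compact (closure A)"
  shows "open ((+) s ` A)" "emeasure \<mu> A < \<infinity>" "emeasure \<mu> ((+) s ` A) = emeasure \<mu> A"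
proof -
  have sets[measurable_cong]: "sets \<mu> = sets borel" using haar unfolding haar_measure_def by simp
  have [measurable]: "(+) s \<in> borel_measurable borel" for s :: 'g
    by (intro borel_measurable_continuous_onI continuous_intros)
  have "(+) s ` A = (+) (- s) -` A" by (force simp: image_iff)
  moreover have "open ((+) (- s) -` A)" by (intro open_vimage A continuous_intros)
  ultimately show op: "open ((+) s ` A)" by simp
  have "emeasure \<mu> A \<le> emeasure \<mu> (closure A)"
    by (intro emeasure_mono) (auto simp: sets closure_subset)
  then show "emeasure \<mu> A < \<infinity>"
    using haar A unfolding haar_measure_def by (metis order_le_less_trans)
  have "emeasure \<mu> ((+) s ` A) = emeasure (distr \<mu> borel ((+) s)) ((+) s ` A)"
    using haar unfolding haar_measure_def by simp
  also have "\<dots> = emeasure \<mu> ((+) s -` (+) s ` A \<inter> space \<mu>)"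
    using op by (intro emeasure_distr) auto
  also have "(+) s -` (+) s ` A \<inter> space \<mu> = A"
    using sets_eq_imp_space_eq[OF sets] by (auto simp: inj_vimage_image_eq)
  finally show "emeasure \<mu> ((+) s ` A) = emeasure \<mu> A" .
qed

lemma haar_set_integrable:
  fixes \<mu> :: "'g::{topological_ab_group_add, t2_space} measure"
    and F :: "'g \<Rightarrow> 'b::{banach, second_countable_topology}"
  assumes haar: "haar_measure \<mu>" and B: "B \<in> sets borel" "emeasure \<mu> B < \<infinity>"
    and F[measurable]: "F \<in> borel_measurable borel" and b: "\<And>t. norm (F t) \<le> b"
  shows "set_integrable \<mu> B F"
  unfolding set_integrable_def
proof (rule Bochner_Integration.integrable_bound)
  have sets[measurable_cong]: "sets \<mu> = sets borel" using haar unfolding haar_measure_def by simp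
  note B(1)[measurable]
  show "integrable \<mu> (\<lambda>t. b * indicator B t :: real)" using B by (simp add: sets)
  show "AE t in \<mu>. norm (indicator B t *\<^sub>R F t) \<le> norm (b * indicator B t)"
    using b by (intro AE_I2) (auto simp: indicator_def intro: order_trans[OF _ abs_ge_self])
  show "(\<lambda>t. indicator B t *\<^sub>R F t) \<in> borel_measurable \<mu>" by measurable
qed

text \<open>
  By invariance the first integral is the integral of \<open>F\<close> over \<open>s + A\<close>, so the two integrals cancel
  outside the symmetric difference. Together with the Folner condition this makes means over \<open>A n\<close>
  asymptotically invariant under translation.
\<close>
lemma haar_integral_shift_bound:
  fixes \<mu> :: "'g::{topological_ab_group_add, t2_space} measure"
    and F :: "'g \<Rightarrow> 'b::{banach, second_countable_topology}"
  assumes haar: "haar_measure \<mu>" and A: "open A" "compact (closure A)"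
    and F[measurable]: "F \<in> borel_measurable borel" and b: "\<And>t. norm (F t) \<le> b"
  shows "norm ((LINT t:A|\<mu>. F (s + t)) - (LINT t:A|\<mu>. F t)) \<le> b * measure \<mu> (sym_diff A ((+) s ` A))"
proof -
  have sets[measurable_cong]: "sets \<mu> = sets borel" using haar unfolding haar_measure_def by simp
  have [measurable]: "(+) s \<in> borel_measurable borel"
    by (intro borel_measurable_continuous_onI continuous_intros)
  define A' where "A' = (+) s ` A"
  note tr = haar_measure_translate(1,3)[OF haar A, of s, folded A'_def] haar_measure_translate(2)[OF haar A]
  have [measurable]: "A \<in> sets borel" "A' \<in> sets borel" using A tr by auto
  have fin: "emeasure \<mu> A < \<infinity>" "emeasure \<mu> A' < \<infinity>" using tr by simp_all
  note int = haar_set_integrable[OF haar _ _ F b, unfolded set_integrable_def]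
  have "(LINT t:A|\<mu>. F (s + t)) = (LINT t|\<mu>. indicator A' (s + t) *\<^sub>R F (s + t))"
    unfolding set_lebesgue_integral_def A'_def
    by (intro Bochner_Integration.integral_cong) (auto simp: indicator_def)
  also have "\<dots> = (LINT t|distr \<mu> borel ((+) s). indicator A' t *\<^sub>R F t)"
    by (rule integral_distr[symmetric]) measurable
  also have "\<dots> = (LINT t|\<mu>. indicator A' t *\<^sub>R F t)"
    using haar unfolding haar_measure_def by simp
  finally have "(LINT t:A|\<mu>. F (s + t)) - (LINT t:A|\<mu>. F t)
      = (LINT t|\<mu>. indicator A' t *\<^sub>R F t - indicator A t *\<^sub>R F t)"
    using int fin unfolding set_lebesgue_integral_def by (subst Bochner_Integration.integral_diff) auto
  also have "norm \<dots> \<le> (LINT t|\<mu>. b * indicator (sym_diff A A') t)"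
  proof (rule order_trans[OF integral_norm_bound integral_mono])
    show "integrable \<mu> (\<lambda>t. norm (indicator A' t *\<^sub>R F t - indicator A t *\<^sub>R F t))"
      using int fin by (intro integrable_norm Bochner_Integration.integrable_diff) auto
    have "emeasure \<mu> (sym_diff A A') \<le> emeasure \<mu> (A \<union> A')" by (intro emeasure_mono) (auto simp: sets)
    also have "\<dots> \<le> emeasure \<mu> A + emeasure \<mu> A'" by (intro emeasure_subadditive) (auto simp: sets)
    also have "\<dots> < \<infinity>" using fin by simp
    finally show "integrable \<mu> (\<lambda>t. b * indicator (sym_diff A A') t :: real)" by (auto simp: sets)
    show "norm (indicator A' t *\<^sub>R F t - indicator A t *\<^sub>R F t) \<le> b * indicator (sym_diff A A') t" for t
      using b[of t] by (auto simp: indicator_def)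
  qed
  also have "\<dots> = b * measure \<mu> (sym_diff A A')"
    using sets_eq_imp_space_eq[OF sets] by simp
  finally show ?thesis unfolding A'_def .
qed

text \<open>
  Means along a piece of an orbit become integrals against this probability measure on \<open>X\<close>, so that
  weak compactness applies to them.
\<close>
definition orbit_measure ::
  "'g measure \<Rightarrow> ('g \<Rightarrow> 'x::topological_space \<Rightarrow> 'x) \<Rightarrow> 'g set \<Rightarrow> 'x \<Rightarrow> 'x measure" where
  "orbit_measure \<mu> act A x = distr (uniform_measure \<mu> A) borel (\<lambda>t. act t x)"

lemma sets_orbit_measure [simp]: "sets (orbit_measure \<mu> act A x) = sets borel"
  unfolding orbit_measure_def by simp

lemma orbit_measure:
  fixes \<phi> :: "'x::topological_space \<Rightarrow> real"
  assumes "A \<in> sets \<mu>" "emeasure \<mu> A < \<infinity>" "measure \<mu> A > 0" and [measurable]: "(\<lambda>t. act t x) \<in> borel_measurable \<mu>"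
  shows "prob_space (orbit_measure \<mu> act A x)"
    and "\<phi> \<in> borel_measurable borel \<Longrightarrow>
      integral\<^sup>L (orbit_measure \<mu> act A x) \<phi> = (LINT t:A|\<mu>. \<phi> (act t x)) / measure \<mu> A"
proof -
  have em: "emeasure \<mu> A = ennreal (measure \<mu> A)" using assms(2) by (intro emeasure_eq_ennreal_measure) auto
  have [measurable]: "(\<lambda>t. act t x) \<in> borel_measurable (uniform_measure \<mu> A)"
    using assms(4) by (simp cong: measurable_cong_sets)
  show "prob_space (orbit_measure \<mu> act A x)"
    unfolding orbit_measure_def
    by (intro prob_space.prob_space_distr prob_space_uniform_measure) (use assms em in auto)
  assume [measurable]: "\<phi> \<in> borel_measurable borel"
  have A[measurable]: "A \<in> sets \<mu>" by fact
  have um: "uniform_measure \<mu> A = density \<mu> (\<lambda>t. ennreal (indicator A t / measure \<mu> A))"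
    unfolding uniform_measure_def em using assms(3)
    by (intro arg_cong[where f = "density \<mu>"] ext) (auto simp: indicator_def divide_ennreal simp flip: ennreal_1)
  have "integral\<^sup>L (orbit_measure \<mu> act A x) \<phi> = (LINT t|uniform_measure \<mu> A. \<phi> (act t x))"
    unfolding orbit_measure_def by (rule integral_distr) measurable
  also have "\<dots> = (LINT t|\<mu>. (indicator A t / measure \<mu> A) *\<^sub>R \<phi> (act t x))"
    unfolding um by (rule integral_density) (auto intro!: AE_I2)
  also have "\<dots> = (LINT t|\<mu>. (indicator A t *\<^sub>R \<phi> (act t x)) / measure \<mu> A)"
    by simp
  also have "\<dots> = (LINT t:A|\<mu>. \<phi> (act t x)) / measure \<mu> A"
    unfolding set_lebesgue_integral_def by (rule integral_divide_zero)
  finally show "integral\<^sup>L (orbit_measure \<mu> act A x) \<phi> = (LINT t:A|\<mu>. \<phi> (act t x)) / measure \<mu> A" .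
qed

lemma continuous_action_continuous:
  assumes "continuous_action act"
  shows "continuous_on UNIV (act t)" "continuous_on UNIV (\<lambda>t. act t x)"
proof -
  have c: "continuous_on UNIV (\<lambda>(t, x). act t x)" using assms unfolding continuous_action_def by simp
  show "continuous_on UNIV (act t)"
    using continuous_on_compose2[OF c, of UNIV "\<lambda>x. (t, x)"] by (simp add: continuous_on_Pair)
  show "continuous_on UNIV (\<lambda>t. act t x)"
    using continuous_on_compose2[OF c, of UNIV "\<lambda>t. (t, x)"] by (simp add: continuous_on_Pair)
qed

text \<open>
  If the bound failed for infinitely many \<open>n\<close>, with points \<open>x n\<close>, then the orbit distributions would have
  a weak limit \<open>\<nu>\<close> along a subsequence. The Folner condition makes \<open>\<nu>\<close> invariant, so \<open>\<nu> = m\<close>,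
  although \<open>\<integral>\<phi> d\<nu> \<ge> \<integral>\<phi> dm + e\<close>.
\<close>
lemma uniquely_ergodic_averages_le:
  fixes \<mu> :: "'g::{topological_ab_group_add, t2_space} measure"
    and act :: "'g \<Rightarrow> 'x::topological_space \<Rightarrow> 'x" and \<phi> :: "'x \<Rightarrow> real"
  assumes haar: "haar_measure \<mu>" and fol: "folner_sequence \<mu> A"
    and comp: "compact (UNIV :: 'x set)" and metr: "metrizable_space (euclidean :: 'x topology)"
    and act: "continuous_action act" and ue: "uniquely_ergodic act" and inv: "invariant_prob act m"
    and \<phi>: "continuous_on UNIV \<phi>" and "e > 0"
  shows "\<forall>\<^sub>F n in sequentially. \<forall>x. (LINT t:A n|\<mu>. \<phi> (act t x)) / measure \<mu> (A n) \<le> integral\<^sup>L m \<phi> + e"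
proof (rule ccontr)
  assume "\<not> ?thesis"
  from not_eventually_sequentiallyD[OF this] obtain r :: "nat \<Rightarrow> nat" where r: "strict_mono r"
    and "\<And>k. \<not> (\<forall>x. (LINT t:A (r k)|\<mu>. \<phi> (act t x)) / measure \<mu> (A (r k)) \<le> integral\<^sup>L m \<phi> + e)"
    by blast
  then obtain x where x: "\<And>k. (LINT t:A (r k)|\<mu>. \<phi> (act t (x k))) / measure \<mu> (A (r k)) > integral\<^sup>L m \<phi> + e"
    by (metis not_le)
  have sets[measurable_cong]: "sets \<mu> = sets borel" using haar unfolding haar_measure_def by simp
  have A: "open (A n)" "compact (closure (A n))" "measure \<mu> (A n) > 0" for n
    using fol unfolding folner_sequence_def by auto
  have [measurable]: "(\<lambda>t. act t x) \<in> borel_measurable borel" "act t \<in> borel_measurable borel" for t x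
    using continuous_action_continuous[OF act] by (auto intro: borel_measurable_continuous_onI)
  have fin: "emeasure \<mu> (A n) < \<infinity>" for n by (rule haar_measure_translate(2)[OF haar A(1,2)])
  have prob: "prob_space (orbit_measure \<mu> act (A n) x)" for n x
    by (rule orbit_measure(1)) (use A fin in \<open>auto simp: sets\<close>)
  have avg: "integral\<^sup>L (orbit_measure \<mu> act (A n) x) \<psi> = (LINT t:A n|\<mu>. \<psi> (act t x)) / measure \<mu> (A n)"
    if "\<psi> \<in> borel_measurable borel" for n x and \<psi> :: "'x \<Rightarrow> real"
    by (rule orbit_measure(2)) (use A fin that in \<open>auto simp: sets\<close>)
  obtain r' \<nu> where r': "strict_mono (r' :: nat \<Rightarrow> nat)" and \<nu>: "prob_space \<nu>" "sets \<nu> = sets borel"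
    and lim: "\<And>\<psi> :: 'x \<Rightarrow> real. continuous_on UNIV \<psi> \<Longrightarrow>
       (\<lambda>k. integral\<^sup>L (orbit_measure \<mu> act (A (r (r' k))) (x (r' k))) \<psi>) \<longlonglongrightarrow> integral\<^sup>L \<nu> \<psi>"
    using borel_prob_weakly_seq_compact[OF comp metr, of "\<lambda>k. orbit_measure \<mu> act (A (r k)) (x k)",
        OF prob sets_orbit_measure] by blast
  note \<nu>(2)[measurable_cong]
  have "distr \<nu> borel (act s) = \<nu>" for s
  proof (rule borel_prob_eqI_continuous[OF metr])
    show "prob_space (distr \<nu> borel (act s))" using \<nu>(1) by (rule prob_space.prob_space_distr) measurable
    show "prob_space \<nu>" by fact
    fix \<psi> :: "'x \<Rightarrow> real" assume \<psi>: "continuous_on UNIV \<psi>"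
    then have [measurable]: "\<psi> \<in> borel_measurable borel" by (rule borel_measurable_continuous_onI)
    obtain b where b: "b > 0" "\<And>x. norm (\<psi> x) \<le> b" using compact_continuous_bounded[OF comp \<psi>] by blast
    have c: "continuous_on UNIV (\<lambda>x. \<psi> (act s x))"
      using continuous_on_compose2[OF \<psi> continuous_action_continuous(1)[OF act]] by simp
    define a where "a k = integral\<^sup>L (orbit_measure \<mu> act (A (r (r' k))) (x (r' k))) (\<lambda>x. \<psi> (act s x))
      - integral\<^sup>L (orbit_measure \<mu> act (A (r (r' k))) (x (r' k))) \<psi>" for k
    have "a \<longlonglongrightarrow> integral\<^sup>L \<nu> (\<lambda>x. \<psi> (act s x)) - integral\<^sup>L \<nu> \<psi>"
      unfolding a_def by (intro tendsto_diff lim c \<psi>)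
    moreover have "a \<longlonglongrightarrow> 0"
    proof (rule Lim_null_comparison)
      define q where "q n = measure \<mu> (sym_diff (A n) ((+) s ` A n)) / measure \<mu> (A n)" for n
      have "q \<longlonglongrightarrow> 0" using fol unfolding folner_sequence_def q_def by blast
      then have "(q \<circ> (r \<circ> r')) \<longlonglongrightarrow> 0" by (rule LIMSEQ_subseq_LIMSEQ) (intro strict_mono_o r r')
      then show "(\<lambda>k. b * q (r (r' k))) \<longlonglongrightarrow> 0" using tendsto_mult_right_zero by (auto simp: o_def)
      have "norm (a k) \<le> b * q (r (r' k))" for k
      proof -
        define n y where "n = r (r' k)" and "y = x (r' k)"
        have "a k = ((LINT t:A n|\<mu>. \<psi> (act (s + t) y)) - (LINT t:A n|\<mu>. \<psi> (act t y))) / measure \<mu> (A n)"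
          using act unfolding a_def n_def[symmetric] y_def[symmetric] continuous_action_def
          by (simp add: avg diff_divide_distrib)
        also have "norm \<dots> \<le> b * measure \<mu> (sym_diff (A n) ((+) s ` A n)) / measure \<mu> (A n)"
          unfolding norm_divide using A(3)[of n]
          by (intro order_trans[OF divide_right_mono[OF haar_integral_shift_bound[OF haar A(1,2) _ b(2)]]]) auto
        finally show ?thesis unfolding q_def n_def by simp
      qed
      then show "\<forall>\<^sub>F k in sequentially. norm (a k) \<le> b * q (r (r' k))" by simp
    qed
    ultimately have "integral\<^sup>L \<nu> (\<lambda>x. \<psi> (act s x)) = integral\<^sup>L \<nu> \<psi>"
      using LIMSEQ_unique by fastforce
    then show "integral\<^sup>L (distr \<nu> borel (act s)) \<psi> = integral\<^sup>L \<nu> \<psi>"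
      by (subst integral_distr) measurable
  qed (simp_all add: \<nu>(2))
  then have "invariant_prob act \<nu>" unfolding invariant_prob_def using \<nu> by simp
  then have "\<nu> = m" using ue inv unfolding uniquely_ergodic_def by blast
  have "integral\<^sup>L m \<phi> + e \<le> integral\<^sup>L \<nu> \<phi>"
  proof (rule LIMSEQ_le_const[OF lim[OF \<phi>]], intro exI allI impI)
    fix k
    show "integral\<^sup>L m \<phi> + e \<le> integral\<^sup>L (orbit_measure \<mu> act (A (r (r' k))) (x (r' k))) \<phi>"
      using x[of "r' k"] by (subst avg) (auto intro: borel_measurable_continuous_onI[OF \<phi>])
  qed
  then show False using \<open>\<nu> = m\<close> \<open>e > 0\<close> by simp
qed

section \<open>Vectors of least norm and eigenfunctions\<close>

lemma Fatou_square_integral: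
  fixes u :: "nat \<Rightarrow> 'a \<Rightarrow> 'b::{banach, second_countable_topology}"
  assumes [measurable]: "\<And>k. u k \<in> borel_measurable M" "v \<in> borel_measurable M"
    and lim: "AE x in M. (\<lambda>k. u k x) \<longlonglongrightarrow> v x"
    and int: "\<And>k. integrable M (\<lambda>x. (norm (u k x))\<^sup>2)"
    and bd: "eventually (\<lambda>k. (LINT x|M. (norm (u k x))\<^sup>2) \<le> c) sequentially" and "0 \<le> c"
  shows "integrable M (\<lambda>x. (norm (v x))\<^sup>2)" "(LINT x|M. (norm (v x))\<^sup>2) \<le> c"
proof -
  have "(\<integral>\<^sup>+x. ennreal ((norm (v x))\<^sup>2) \<partial>M) = (\<integral>\<^sup>+x. liminf (\<lambda>k. ennreal ((norm (u k x))\<^sup>2)) \<partial>M)"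
  proof (rule nn_integral_cong_AE)
    show "AE x in M. ennreal ((norm (v x))\<^sup>2) = liminf (\<lambda>k. ennreal ((norm (u k x))\<^sup>2))"
      using lim
    proof eventually_elim
      case (elim x)
      have "(\<lambda>k. ennreal ((norm (u k x))\<^sup>2)) \<longlonglongrightarrow> ennreal ((norm (v x))\<^sup>2)"
        using elim by (intro tendsto_intros)
      then show ?case by (intro lim_imp_Liminf[symmetric]) auto
    qed
  qed
  also have "\<dots> \<le> liminf (\<lambda>k. \<integral>\<^sup>+x. ennreal ((norm (u k x))\<^sup>2) \<partial>M)"
    by (rule nn_integral_liminf) measurable
  also have "\<dots> \<le> ennreal c"
  proof -
    have "eventually (\<lambda>k. (\<integral>\<^sup>+x. ennreal ((norm (u k x))\<^sup>2) \<partial>M) \<le> ennreal c) sequentially"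
      using bd by eventually_elim (simp add: nn_integral_eq_integral[OF int] ennreal_leI)
    then have "limsup (\<lambda>k. \<integral>\<^sup>+x. ennreal ((norm (u k x))\<^sup>2) \<partial>M) \<le> ennreal c"
      by (rule Limsup_bounded)
    then show ?thesis by (rule order_trans[OF Liminf_le_Limsup[OF trivial_limit_sequentially]])
  qed
  finally have le: "(\<integral>\<^sup>+x. ennreal ((norm (v x))\<^sup>2) \<partial>M) \<le> ennreal c" .
  show int': "integrable M (\<lambda>x. (norm (v x))\<^sup>2)"
  proof (rule integrableI_bounded)
    show "(\<integral>\<^sup>+x. ennreal (norm ((norm (v x))\<^sup>2)) \<partial>M) < \<infinity>"
      using order_le_less_trans[OF le, of \<infinity>] by simp
  qed measurable
  have "(\<integral>\<^sup>+x. ennreal ((norm (v x))\<^sup>2) \<partial>M) = ennreal (LINT x|M. (norm (v x))\<^sup>2)"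
    by (rule nn_integral_eq_integral[OF int']) simp
  then show "(LINT x|M. (norm (v x))\<^sup>2) \<le> c"
    using le \<open>0 \<le> c\<close> by (simp add: ennreal_le_iff)
qed

lemma complex_parallelogram:
  fixes z w :: complex
  shows "(norm (z - w))\<^sup>2 = 2 * (norm z)\<^sup>2 + 2 * (norm w)\<^sup>2 - 4 * (norm ((z + w) / 2))\<^sup>2"
proof -
  have "4 * (norm ((z + w) / 2))\<^sup>2 = (norm (z + w))\<^sup>2"
    by (simp add: norm_divide power_divide)
  then show ?thesis
    unfolding cmod_power2 by (simp add: power2_eq_square algebra_simps)
qed

lemma square_integrable_diff:
  fixes g h :: "'a \<Rightarrow> complex"
  assumes [measurable]: "g \<in> borel_measurable M" "h \<in> borel_measurable M"
    and "integrable M (\<lambda>x. (norm (g x))\<^sup>2)" "integrable M (\<lambda>x. (norm (h x))\<^sup>2)"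
  shows "integrable M (\<lambda>x. (norm (g x - h x))\<^sup>2)"
proof (rule Bochner_Integration.integrable_bound)
  show "integrable M (\<lambda>x. 2 * (norm (g x))\<^sup>2 + 2 * (norm (h x))\<^sup>2)" using assms by auto
  show "AE x in M. norm ((norm (g x - h x))\<^sup>2) \<le> norm (2 * (norm (g x))\<^sup>2 + 2 * (norm (h x))\<^sup>2)"
  proof (rule AE_I2)
    fix x
    have "(norm (g x - h x))\<^sup>2 \<le> 2 * (norm (g x))\<^sup>2 + 2 * (norm (h x))\<^sup>2"
      unfolding complex_parallelogram by simp
    then show "norm ((norm (g x - h x))\<^sup>2) \<le> norm (2 * (norm (g x))\<^sup>2 + 2 * (norm (h x))\<^sup>2)"
      by simp
  qed
qed measurable

text \<open>
  The parallelogram law, integrated. It is used when \<open>d\<close> is the infimum of the square norms over a set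
  closed under midpoints: then functions of almost minimal norm are close to each other.
\<close>
lemma midpoint_gap:
  fixes g h :: "'a \<Rightarrow> complex"
  assumes [measurable]: "g \<in> borel_measurable M" "h \<in> borel_measurable M"
    and i: "integrable M (\<lambda>x. (norm (g x))\<^sup>2)" "integrable M (\<lambda>x. (norm (h x))\<^sup>2)"
      "integrable M (\<lambda>x. (norm ((g x + h x) / 2))\<^sup>2)"
    and d: "d \<le> (LINT x|M. (norm ((g x + h x) / 2))\<^sup>2)"
  shows "(LINT x|M. (norm (g x - h x))\<^sup>2)
    \<le> 2 * (LINT x|M. (norm (g x))\<^sup>2) + 2 * (LINT x|M. (norm (h x))\<^sup>2) - 4 * d"
proof -
  have "(LINT x|M. (norm (g x - h x))\<^sup>2) = (LINT x|M. 2 * (norm (g x))\<^sup>2 + 2 * (norm (h x))\<^sup>2 - 4 * (norm ((g x + h x) / 2))\<^sup>2)"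
    by (simp only: complex_parallelogram)
  also have "\<dots> = 2 * (LINT x|M. (norm (g x))\<^sup>2) + 2 * (LINT x|M. (norm (h x))\<^sup>2) - 4 * (LINT x|M. (norm ((g x + h x) / 2))\<^sup>2)"
    using i by (subst Bochner_Integration.integral_diff Bochner_Integration.integral_add integral_mult_right_zero; simp)+
  finally show ?thesis using d by simp
qed

text \<open>
  A quantitative form of the inclusion of \<open>L\<^sup>2\<close> in \<open>L\<^sup>1\<close> on a probability space, obtained by
  integrating \<open>2 * |u| \<le> e + |u|\<^sup>2 / e\<close>.
\<close>
lemma (in prob_space) L1_less_if_L2_less:
  fixes u :: "'a \<Rightarrow> complex"
  assumes [measurable]: "u \<in> borel_measurable M" and i: "integrable M (\<lambda>x. (norm (u x))\<^sup>2)"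
    and "(LINT x|M. (norm (u x))\<^sup>2) < e\<^sup>2" "e > 0"
  shows "integrable M u" "(LINT x|M. norm (u x)) < e"
proof -
  have bd: "norm (u x) \<le> e / 2 + (norm (u x))\<^sup>2 / (2 * e)" for x
  proof -
    have "0 \<le> (norm (u x) - e)\<^sup>2" by simp
    then show ?thesis using \<open>e > 0\<close> by (simp add: power2_eq_square field_simps)
  qed
  have i2: "integrable M (\<lambda>x. e / 2 + (norm (u x))\<^sup>2 / (2 * e))" using i by auto
  show iu: "integrable M u"
    by (rule Bochner_Integration.integrable_bound[OF i2])
      (use bd \<open>e > 0\<close> in \<open>auto intro!: AE_I2 order_trans[OF bd] simp: abs_of_nonneg\<close>)
  have "(LINT x|M. norm (u x)) \<le> (LINT x|M. e / 2 + (norm (u x))\<^sup>2 / (2 * e))"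
    using bd iu i2 by (intro integral_mono) auto
  also have "\<dots> = e / 2 + (LINT x|M. (norm (u x))\<^sup>2) / (2 * e)"
    using i by (simp add: prob_space)
  also have "\<dots> < e / 2 + e\<^sup>2 / (2 * e)"
    using assms(3,4) by (intro add_strict_left_mono divide_strict_right_mono) auto
  also have "\<dots> = e" using assms(4) by (simp add: power2_eq_square)
  finally show "(LINT x|M. norm (u x)) < e" .
qed

text \<open>
  A minimizing sequence in a set that is closed under midpoints is Cauchy in \<open>L\<^sup>2\<close> by the
  parallelogram law, hence in \<open>L\<^sup>1\<close>, and a subsequence converges almost everywhere. The limit is not zero:
  by Fatou's lemma \<open>g n - h\<close> has small norm for large \<open>n\<close>, whereas \<open>g n\<close> itself has norm at least
  \<open>sqrt d\<close>.
\<close>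
lemma (in prob_space) minimal_L2_norm_limit:
  fixes C :: "('a \<Rightarrow> complex) set"
  assumes ne: "C \<noteq> {}"
    and meas: "\<And>g. g \<in> C \<Longrightarrow> g \<in> borel_measurable M"
    and int: "\<And>g. g \<in> C \<Longrightarrow> integrable M (\<lambda>x. (norm (g x))\<^sup>2)"
    and mid: "\<And>g h. g \<in> C \<Longrightarrow> h \<in> C \<Longrightarrow> (\<lambda>x. (g x + h x) / 2) \<in> C"
    and d: "d = (INF g\<in>C. LINT x|M. (norm (g x))\<^sup>2)" "d > 0"
  obtains g h where "\<And>k. g k \<in> C" "h \<in> borel_measurable M" "integrable M (\<lambda>x. (norm (h x))\<^sup>2)"
    "AE x in M. (\<lambda>k. g k x) \<longlonglongrightarrow> h x" "(\<lambda>k. LINT x|M. (norm (g k x))\<^sup>2) \<longlonglongrightarrow> d"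
    "\<not> (AE x in M. h x = 0)"
proof -
  define N where "N g = (LINT x|M. (norm (g x))\<^sup>2)" for g :: "'a \<Rightarrow> complex"
  have bb: "bdd_below (N ` C)" unfolding N_def by (intro bdd_belowI2[of _ 0]) auto
  have dN: "d \<le> N g" if "g \<in> C" for g
    using cINF_lower[OF bb that] unfolding d N_def by simp
  have "\<exists>g\<in>C. N g < d + 1 / real (Suc k)" for k
    using cInf_lessD[of "N ` C" "d + 1 / real (Suc k)"] ne unfolding d(1) N_def by force
  then obtain g0 where g0: "\<And>k. g0 k \<in> C" "\<And>k. N (g0 k) < d + 1 / real (Suc k)" by metis
  have [measurable]: "g0 k \<in> borel_measurable M" for k using meas g0 by auto
  have gap: "N (\<lambda>x. g0 i x - g0 j x) \<le> 4 / real (Suc n)" if "i \<ge> n" "j \<ge> n" for i j n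
  proof -
    have "N (\<lambda>x. g0 i x - g0 j x) \<le> 2 * N (g0 i) + 2 * N (g0 j) - 4 * d"
      unfolding N_def using g0(1) dN[OF mid[OF g0(1) g0(1)]]
      by (intro midpoint_gap meas int mid) (auto simp: N_def)
    moreover have "N (g0 i) < d + 1 / real (Suc n)"
      using g0(2)[of i] that by (intro order.strict_trans2[OF g0(2)]) (auto simp: frac_le)
    moreover have "N (g0 j) < d + 1 / real (Suc n)"
      using g0(2)[of j] that by (intro order.strict_trans2[OF g0(2)]) (auto simp: frac_le)
    ultimately show ?thesis by simp
  qed
  have idiff: "integrable M (\<lambda>x. (norm (g0 i x - g0 j x))\<^sup>2)" for i j
    using g0(1) by (intro square_integrable_diff meas int)
  have small: "\<exists>n. 4 / real (Suc n) < e" if e: "e > 0" for e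
  proof -
    obtain n where "inverse (real (Suc n)) < e / 4"
      using reals_Archimedean[of "e / 4"] e by (metis divide_pos_pos zero_less_numeral)
    then show ?thesis by (intro exI[of _ n]) (simp add: field_simps)
  qed
  have i1: "integrable M (g0 i)" for i
  proof -
    have "N (g0 i) < (1 + N (g0 i))\<^sup>2" and "1 + N (g0 i) > 0"
      using dN[OF g0(1)[of i]] d(2) by (auto simp: power2_eq_square algebra_simps intro: add_pos_nonneg)
    then show ?thesis using int[OF g0(1)] unfolding N_def by (intro L1_less_if_L2_less(1)) auto
  qed
  have "\<exists>n. \<forall>i\<ge>n. \<forall>j\<ge>n. (LINT x|M. norm (g0 i x - g0 j x)) < e" if e: "e > 0" for e
  proof -
    obtain n where n: "4 / real (Suc n) < e\<^sup>2" using small[OF zero_less_power[OF e]] by blast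
    show ?thesis
      using gap[of n] n e idiff unfolding N_def
      by (intro exI[of _ n] allI impI L1_less_if_L2_less(2)) (auto intro: order.strict_trans1)
  qed
  from cauchy_L1_AE_cauchy_subseq[OF i1 this]
  obtain r where r: "strict_mono r" and cau: "AE x in M. Cauchy (\<lambda>k. g0 (r k) x)" by blast
  define h where "h x = lim (\<lambda>k. g0 (r k) x)" for x
  have [measurable]: "h \<in> borel_measurable M" unfolding h_def by measurable
  have lim: "AE x in M. (\<lambda>k. g0 (r k) x) \<longlonglongrightarrow> h x"
    using cau by eventually_elim (auto simp: h_def Cauchy_convergent_iff convergent_LIMSEQ_iff)
  have r_ge: "k \<le> r k" for k using r by (rule seq_suble)
  have Nlim: "(\<lambda>k. N (g0 (r k))) \<longlonglongrightarrow> d"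
  proof (rule tendsto_sandwich[of "\<lambda>_. d" _ _ "\<lambda>k. d + 1 / real (Suc k)"])
    show "\<forall>\<^sub>F k in sequentially. N (g0 (r k)) \<le> d + 1 / real (Suc k)"
    proof (intro always_eventually allI)
      fix k
      have "1 / real (Suc (r k)) \<le> 1 / real (Suc k)" using r_ge[of k] by (simp add: frac_le)
      then show "N (g0 (r k)) \<le> d + 1 / real (Suc k)" using g0(2)[of "r k"] by linarith
    qed
    show "(\<lambda>k. d + 1 / real (Suc k)) \<longlonglongrightarrow> d"
      using LIMSEQ_inverse_real_of_nat_add[of d] unfolding inverse_eq_divide .
  qed (use dN g0 in \<open>auto intro!: always_eventually\<close>)
  have ih: "integrable M (\<lambda>x. (norm (h x))\<^sup>2)"
  proof (rule Fatou_square_integral(1)[OF _ _ lim])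
    show "\<forall>\<^sub>F k in sequentially. (LINT x|M. (norm (g0 (r k) x))\<^sup>2) \<le> d + 1"
      using order_tendstoD(2)[OF Nlim, of "d + 1"] unfolding N_def by (auto elim: eventually_mono)
  qed (use int g0 d(2) in auto)
  have "\<not> (AE x in M. h x = 0)"
  proof
    assume h0: "AE x in M. h x = 0"
    obtain n where n: "4 / real (Suc n) < d" using small d(2) by blast
    have "(LINT x|M. (norm (g0 n x))\<^sup>2) \<le> 4 / real (Suc n)"
    proof (rule Fatou_square_integral(2)[of "\<lambda>k x. g0 n x - g0 (r k) x"])
      show "AE x in M. (\<lambda>k. g0 n x - g0 (r k) x) \<longlonglongrightarrow> g0 n x"
        using lim h0
      proof eventually_elim
        case (elim x)
        then show ?case using tendsto_diff[OF tendsto_const elim(1), of "g0 n x"] by simp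
      qed
      show "\<forall>\<^sub>F k in sequentially. (LINT x|M. (norm (g0 n x - g0 (r k) x))\<^sup>2) \<le> 4 / real (Suc n)"
        using gap[of n n] r_ge unfolding N_def eventually_sequentially by (meson order_refl order_trans)
    qed (use idiff in auto)
    then show False using dN[OF g0(1)[of n]] n unfolding N_def by simp
  qed
  then show ?thesis using that[of "\<lambda>k. g0 (r k)" h] g0(1) ih lim Nlim unfolding N_def by auto
qed

text \<open>
  If the norms of the functions in \<open>C\<close> stayed away from zero, the almost everywhere limit \<open>h\<close> of a minimizing
  sequence \<open>g\<close> would be a nonzero eigenfunction. Indeed, \<open>cnj (\<xi> t) * g k (t.x)\<close> is another
  minimizing sequence, since it stays in \<open>C\<close> and has the same norms; by the parallelogram law it has the same limit.
\<close>
lemma small_twisted_average_if_not_eigenvalue: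
  fixes act :: "'g::{topological_ab_group_add, t2_space} \<Rightarrow> 'x::topological_space \<Rightarrow> 'x"
  assumes inv: "invariant_prob act m" and act: "\<And>t. act t \<in> borel_measurable borel"
    and xi: "\<xi> \<in> dual_group" "\<xi> \<notin> eigenvalues act m"
    and ne: "C \<noteq> {}"
    and meas: "\<And>g. g \<in> C \<Longrightarrow> g \<in> borel_measurable borel"
    and int: "\<And>g. g \<in> C \<Longrightarrow> integrable m (\<lambda>x. (norm (g x))\<^sup>2)"
    and mid: "\<And>g h. g \<in> C \<Longrightarrow> h \<in> C \<Longrightarrow> (\<lambda>x. (g x + h x) / 2) \<in> C"
    and tw: "\<And>g t. g \<in> C \<Longrightarrow> (\<lambda>x. cnj (\<xi> t) * g (act t x)) \<in> C"
    and "e > 0"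
  shows "\<exists>g\<in>C. (LINT x|m. norm (g x)) < e"
proof -
  interpret prob_space m using inv unfolding invariant_prob_def by simp
  have sets_m[measurable_cong]: "sets m = sets borel" using inv unfolding invariant_prob_def by simp
  note act[measurable]
  have pres: "distr m borel (act t) = m" for t using inv unfolding invariant_prob_def by simp
  have meas_m[measurable]: "g \<in> borel_measurable m" if "g \<in> C" for g
    using meas[OF that] by measurable
  have unit: "norm (\<xi> t) = 1" for t using xi unfolding dual_group_def by simp
  define N where "N g = (LINT x|m. (norm (g x))\<^sup>2)" for g :: "'x \<Rightarrow> complex"
  define d where "d = (INF g\<in>C. N g)"
  have bb: "bdd_below (N ` C)" unfolding N_def by (intro bdd_belowI2[of _ 0]) auto
  have "\<not> d > 0"
  proof
    assume "d > 0"
    have d: "d = (INF g\<in>C. LINT x|m. (norm (g x))\<^sup>2)" unfolding d_def N_def ..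
    obtain g h where g: "\<And>k. g k \<in> C" and h[measurable]: "h \<in> borel_measurable m"
      and ih: "integrable m (\<lambda>x. (norm (h x))\<^sup>2)"
      and lim: "AE x in m. (\<lambda>k. g k x) \<longlonglongrightarrow> h x" and Nlim: "(\<lambda>k. N (g k)) \<longlonglongrightarrow> d"
      and nz: "\<not> (AE x in m. h x = 0)"
      using minimal_L2_norm_limit[OF ne meas_m int mid d \<open>d > 0\<close>] unfolding N_def by blast
    have hb[measurable]: "h \<in> borel_measurable borel" using h by (simp cong: measurable_cong_sets add: sets_m)
    have "AE x in m. h (act t x) = \<xi> t * h x" for t
    proof -
      \<comment> \<open>\<open>u k\<close> tends to zero in \<open>L\<^sup>2\<close> and to \<open>v\<close> almost everywhere, so \<open>v\<close> vanishes.\<close>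
      define u where "u k x = cnj (\<xi> t) * g k (act t x) - g k x" for k x
      define v where "v x = cnj (\<xi> t) * h (act t x) - h x" for x
      have [measurable]: "g k \<in> borel_measurable borel" for k using g meas by auto
      have [measurable]: "u k \<in> borel_measurable m" "v \<in> borel_measurable m" for k
        unfolding u_def v_def by measurable
      have "AE x in distr m borel (act t). (\<lambda>k. g k x) \<longlonglongrightarrow> h x" unfolding pres by (rule lim)
      then have "AE x in m. (\<lambda>k. g k (act t x)) \<longlonglongrightarrow> h (act t x)"
        by (rule AE_distrD[rotated]) measurable
      then have ulim: "AE x in m. (\<lambda>k. u k x) \<longlonglongrightarrow> v x"
        using lim unfolding u_def v_def by eventually_elim (intro tendsto_intros)
      have iu: "integrable m (\<lambda>x. (norm (u k x))\<^sup>2)" for k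
        unfolding u_def using g tw by (intro square_integrable_diff meas_m int) auto
      have Neq: "N (\<lambda>x. cnj (\<xi> t) * g k (act t x)) = N (g k)" for k
      proof -
        have "N (\<lambda>x. cnj (\<xi> t) * g k (act t x)) = (LINT x|m. (norm (g k (act t x)))\<^sup>2)"
          unfolding N_def by (simp add: norm_mult unit)
        also have "\<dots> = (LINT x|distr m borel (act t). (norm (g k x))\<^sup>2)"
          by (rule integral_distr[symmetric]) measurable
        finally show ?thesis unfolding pres N_def .
      qed
      have gap: "N (u k) \<le> 4 * N (g k) - 4 * d" for k
      proof -
        have "N (u k) \<le> 2 * N (\<lambda>x. cnj (\<xi> t) * g k (act t x)) + 2 * N (g k) - 4 * d"
          using g tw cINF_lower[OF bb mid[OF tw[OF g] g]] unfolding N_def u_def d_def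
          by (intro midpoint_gap meas_m int mid) auto
        then show ?thesis using Neq by simp
      qed
      have small: "integrable m (\<lambda>x. (norm (v x))\<^sup>2)" "N v \<le> c" if "c > 0" for c
      proof -
        have "(\<lambda>k. 4 * N (g k) - 4 * d) \<longlonglongrightarrow> 4 * d - 4 * d" by (intro tendsto_intros Nlim)
        then have "\<forall>\<^sub>F k in sequentially. 4 * N (g k) - 4 * d < c"
          using that by (intro order_tendstoD(2)) auto
        then have ev: "\<forall>\<^sub>F k in sequentially. (LINT x|m. (norm (u k x))\<^sup>2) \<le> c"
          using gap unfolding N_def by (auto elim!: eventually_mono intro: order_trans less_imp_le)
        show "integrable m (\<lambda>x. (norm (v x))\<^sup>2)" "N v \<le> c"
          using Fatou_square_integral[OF _ _ ulim iu ev] that unfolding N_def by auto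
      qed
      have "N v \<le> 0" by (rule field_le_epsilon) (use small(2) in auto)
      moreover have "N v \<ge> 0" unfolding N_def by auto
      ultimately have "(LINT x|m. (norm (v x))\<^sup>2) = 0" unfolding N_def by linarith
      then have "AE x in m. (norm (v x))\<^sup>2 = 0"
        using integral_nonneg_eq_0_iff_AE[OF small(1)[of 1]] by auto
      then show ?thesis
      proof eventually_elim
        case (elim x)
        then have "cnj (\<xi> t) * h (act t x) = h x" unfolding v_def by simp
        then have "\<xi> t * h x = (\<xi> t * cnj (\<xi> t)) * h (act t x)" by simp
        also have "\<xi> t * cnj (\<xi> t) = 1" using unit[of t] by (simp add: complex_norm_square[symmetric])
        finally show ?case by simp
      qed
    qed
    then have "\<xi> \<in> eigenvalues act m"
      unfolding eigenvalues_def using xi(1) ih nz h by blast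
    then show False using xi(2) by simp
  qed
  then have "Inf (N ` C) < e\<^sup>2" using \<open>e > 0\<close> unfolding d_def by (smt (verit) zero_less_power)
  then obtain g where g: "g \<in> C" "N g < e\<^sup>2" using cInf_lessD[of "N ` C" "e\<^sup>2"] ne by auto
  then have "(LINT x|m. norm (g x)) < e"
    using int \<open>e > 0\<close> unfolding N_def by (intro L1_less_if_L2_less(2) meas_m) auto
  then show ?thesis using g by blast
qed

section \<open>Twisted averages and uniform convergence\<close>

text \<open>
  For a character \<open>\<xi>\<close> and a continuous action, the functions \<open>F \<xi>\<close> are the convex combinations with dyadic
  weights of the functions \<open>x \<mapsto> cnj (\<xi> s) * f (s.x)\<close>. They are kept as functions of the character \<open>\<xi>\<close> because a combination chosen for one character will be evaluated at
  nearby ones. Midpoints are the only convex combinations that the parallelogram law requires.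
\<close>
inductive_set twisted_averages ::
  "('g \<Rightarrow> 'x \<Rightarrow> 'x) \<Rightarrow> ('x \<Rightarrow> complex) \<Rightarrow> (('g \<Rightarrow> complex) \<Rightarrow> 'x \<Rightarrow> complex) set"
  for act :: "'g \<Rightarrow> 'x \<Rightarrow> 'x" and f :: "'x \<Rightarrow> complex" where
  base: "(\<lambda>\<xi>. f) \<in> twisted_averages act f"
| twist: "F \<in> twisted_averages act f \<Longrightarrow> (\<lambda>\<xi> x. cnj (\<xi> s) * F \<xi> (act s x)) \<in> twisted_averages act f"
| mid: "F \<in> twisted_averages act f \<Longrightarrow> H \<in> twisted_averages act f \<Longrightarrow>
    (\<lambda>\<xi> x. (F \<xi> x + H \<xi> x) / 2) \<in> twisted_averages act f"

lemma twisted_average_continuous: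
  assumes "F \<in> twisted_averages act f" "continuous_action act" "continuous_on UNIV f"
  shows "continuous_on UNIV (F \<xi>)"
  using assms(1)
proof induction
  case base
  then show ?case using assms(3) .
next
  case (twist F s)
  then show ?case
    using continuous_on_compose2[OF twist.IH continuous_action_continuous(1)[OF assms(2)]]
    by (intro continuous_intros) auto
next
  case (mid F H)
  then show ?case by (intro continuous_intros) auto
qed

lemma twisted_average_bounded:
  assumes "F \<in> twisted_averages act f" "\<And>x. norm (f x) \<le> b" "\<xi> \<in> dual_group"
  shows "norm (F \<xi> x) \<le> b"
  using assms(1)
proof (induction arbitrary: x)
  case base
  then show ?case using assms(2) .
next
  case (twist F s)
  then show ?case using assms(3) unfolding dual_group_def by (simp add: norm_mult)
next
  case (mid F H)
  have "norm (F \<xi> x + H \<xi> x) \<le> b + b" by (intro norm_triangle_mono mid.IH)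
  then show ?case by (simp add: norm_divide)
qed

lemma openin_dual_topology_eval:
  "openin dual_topology {\<xi> \<in> dual_group. dist (\<xi> s) z < e}"
proof -
  have "{\<xi> \<in> dual_group. dist (\<xi> s) z < e} = {\<xi> \<in> dual_group. \<xi> ` {s} \<subseteq> ball z e}"
    by (auto simp: dist_commute)
  then show ?thesis
    unfolding dual_topology_def
    by (intro topology_generated_by_Basis CollectI exI[of _ "{s}"] exI[of _ "ball z e"]) auto
qed

text \<open>
  A twisted average involves the character at finitely many points only, and each evaluation is continuous
  on the dual group. The bound on \<open>f\<close> makes the neighbourhood independent of \<open>x\<close>.
\<close>
lemma twisted_average_equicontinuous:
  assumes "F \<in> twisted_averages act f" and b: "\<And>x. norm (f x) \<le> b" "b > 0"
    and xi: "\<xi> \<in> dual_group" and "e > 0"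
  shows "\<exists>U. openin dual_topology U \<and> \<xi> \<in> U \<and> (\<forall>\<eta>\<in>U. \<forall>x. norm (F \<eta> x - F \<xi> x) \<le> e)"
  using assms(1) \<open>e > 0\<close>
proof (induction arbitrary: e)
  case base
  have "openin dual_topology (dual_group :: ('a \<Rightarrow> complex) set)"
    using openin_topspace[of dual_topology] unfolding topspace_dual_topology .
  then show ?case using xi base by (intro exI[of _ dual_group]) auto
next
  case (twist F s)
  obtain U where U: "openin dual_topology U" "\<xi> \<in> U" "\<And>\<eta> x. \<eta> \<in> U \<Longrightarrow> norm (F \<eta> x - F \<xi> x) \<le> e / 2"
    using twist.IH[OF half_gt_zero[OF twist.prems]] by blast
  define V where "V = U \<inter> {\<eta> \<in> dual_group. dist (\<eta> s) (\<xi> s) < e / (2 * b)}"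
  have "openin dual_topology V" unfolding V_def by (intro openin_Int U openin_dual_topology_eval)
  moreover have "\<xi> \<in> V" unfolding V_def using U xi b twist.prems by simp
  moreover have "norm (cnj (\<eta> s) * F \<eta> (act s x) - cnj (\<xi> s) * F \<xi> (act s x)) \<le> e" if \<eta>: "\<eta> \<in> V" for \<eta> x
  proof -
    have "norm (\<eta> s) = 1" using \<eta> unfolding V_def dual_group_def by simp
    then have 1: "norm (cnj (\<eta> s) * (F \<eta> (act s x) - F \<xi> (act s x))) \<le> e / 2"
      using U(3)[of \<eta> "act s x"] \<eta> unfolding V_def norm_mult by simp
    have "norm (cnj (\<eta> s - \<xi> s)) \<le> e / (2 * b)" using \<eta> unfolding V_def dist_norm by (simp only: complex_mod_cnj) simp
    then have 2: "norm (cnj (\<eta> s - \<xi> s) * F \<xi> (act s x)) \<le> e / (2 * b) * b"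
      unfolding norm_mult using twisted_average_bounded[OF twist.hyps b(1) xi] b twist.prems
      by (intro mult_mono) auto
    have eq: "cnj (\<eta> s) * F \<eta> (act s x) - cnj (\<xi> s) * F \<xi> (act s x)
      = cnj (\<eta> s) * (F \<eta> (act s x) - F \<xi> (act s x)) + cnj (\<eta> s - \<xi> s) * F \<xi> (act s x)"
      by (simp add: algebra_simps)
    show ?thesis unfolding eq using norm_triangle_mono[OF 1 2] b by simp
  qed
  ultimately show ?case by blast
next
  case (mid F H)
  obtain U where U: "openin dual_topology U" "\<xi> \<in> U" "\<And>\<eta> x. \<eta> \<in> U \<Longrightarrow> norm (F \<eta> x - F \<xi> x) \<le> e"
    using mid.IH(1)[OF mid.prems] by blast
  obtain V where V: "openin dual_topology V" "\<xi> \<in> V" "\<And>\<eta> x. \<eta> \<in> V \<Longrightarrow> norm (H \<eta> x - H \<xi> x) \<le> e"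
    using mid.IH(2)[OF mid.prems] by blast
  have "norm ((F \<eta> x + H \<eta> x) / 2 - (F \<xi> x + H \<xi> x) / 2) \<le> e" if "\<eta> \<in> U \<inter> V" for \<eta> x
  proof -
    have eq: "(F \<eta> x + H \<eta> x) / 2 - (F \<xi> x + H \<xi> x) / 2 = ((F \<eta> x - F \<xi> x) + (H \<eta> x - H \<xi> x)) / 2"
      by (simp add: field_simps)
    have "norm ((F \<eta> x - F \<xi> x) + (H \<eta> x - H \<xi> x)) \<le> e + e"
      using that U(3) V(3) by (intro norm_triangle_mono) auto
    then show ?thesis unfolding eq by (simp add: norm_divide)
  qed
  then show ?case using U V by (intro exI[of _ "U \<inter> V"]) auto
qed

text \<open>
  For a single twist, \<open>cnj (\<xi> s) * F (s.(t.x)) * cnj (\<xi> t) = G (s + t)\<close> with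
  \<open>G t = F (t.x) * cnj (\<xi> t)\<close>, because \<open>\<xi>\<close> is multiplicative; so the twist only shifts the integrand
  by \<open>s\<close>. The resulting error is bounded in terms of \<open>A n\<close>, \<open>s\<close> and the bound on \<open>f\<close>, which makes it
  uniform in \<open>x\<close> and in the character.
\<close>
lemma twisted_average_same_mean:
  fixes \<mu> :: "'g::{topological_ab_group_add, t2_space} measure"
    and act :: "'g \<Rightarrow> 'x::topological_space \<Rightarrow> 'x"
  assumes "F \<in> twisted_averages act f"
    and haar: "haar_measure \<mu>" and fol: "folner_sequence \<mu> A"
    and act: "continuous_action act" and f: "continuous_on UNIV f" and b: "\<And>x. norm (f x) \<le> b" "b > 0"
  shows "\<exists>q. q \<longlonglongrightarrow> (0 :: real) \<and> (\<forall>n x. \<forall>\<xi>\<in>dual_group.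
    norm ((LINT t:A n|\<mu>. F \<xi> (act t x) * cnj (\<xi> t)) - (LINT t:A n|\<mu>. f (act t x) * cnj (\<xi> t)))
      \<le> q n * measure \<mu> (A n))"
  using assms(1)
proof induction
  case base
  then show ?case by (intro exI[of _ "\<lambda>_. 0"]) auto
next
  case (twist F s)
  then obtain q where q: "q \<longlonglongrightarrow> 0" "\<And>n x \<xi>. \<xi> \<in> dual_group \<Longrightarrow>
    norm ((LINT t:A n|\<mu>. F \<xi> (act t x) * cnj (\<xi> t)) - (LINT t:A n|\<mu>. f (act t x) * cnj (\<xi> t)))
      \<le> q n * measure \<mu> (A n)" by blast
  have A: "open (A n)" "compact (closure (A n))" "measure \<mu> (A n) > 0" for n
    using fol unfolding folner_sequence_def by auto
  define p where "p n = measure \<mu> (sym_diff (A n) ((+) s ` A n)) / measure \<mu> (A n)" for n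
  have "p \<longlonglongrightarrow> 0" using fol unfolding folner_sequence_def p_def by blast
  then have "(\<lambda>n. q n + b * p n) \<longlonglongrightarrow> 0 + b * 0" by (intro tendsto_intros q)
  then have lim: "(\<lambda>n. q n + b * p n) \<longlonglongrightarrow> 0" by simp
  have "norm ((LINT t:A n|\<mu>. cnj (\<xi> s) * F \<xi> (act s (act t x)) * cnj (\<xi> t)) - (LINT t:A n|\<mu>. f (act t x) * cnj (\<xi> t)))
      \<le> (q n + b * p n) * measure \<mu> (A n)" if xi: "\<xi> \<in> dual_group" for n x \<xi>
  proof -
    define G where "G t = F \<xi> (act t x) * cnj (\<xi> t)" for t
    have cxi: "continuous_on UNIV \<xi>" and mxi: "\<xi> (u + v) = \<xi> u * \<xi> v" and nxi: "norm (\<xi> t) = 1" for u v t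
      using xi unfolding dual_group_def by auto
    have "continuous_on UNIV (\<lambda>t. F \<xi> (act t x))"
      using continuous_on_compose2[OF twisted_average_continuous[OF twist.hyps act f] continuous_action_continuous(2)[OF act]] by simp
    then have G: "G \<in> borel_measurable borel"
      unfolding G_def using cxi by (intro borel_measurable_continuous_onI continuous_intros)
    have Gb: "norm (G t) \<le> b" for t
      unfolding G_def using twisted_average_bounded[OF twist.hyps b(1) xi] by (simp add: norm_mult nxi)
    have eq: "(LINT t:A n|\<mu>. cnj (\<xi> s) * F \<xi> (act s (act t x)) * cnj (\<xi> t)) = (LINT t:A n|\<mu>. G (s + t))"
      using act unfolding G_def continuous_action_def by (simp add: mxi mult_ac)
    have 1: "norm ((LINT t:A n|\<mu>. G (s + t)) - (LINT t:A n|\<mu>. G t)) \<le> b * p n * measure \<mu> (A n)"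
      using haar_integral_shift_bound[OF haar A(1,2) G Gb, of n s] A(3)[of n] unfolding p_def by simp
    have "norm ((LINT t:A n|\<mu>. G t) - (LINT t:A n|\<mu>. f (act t x) * cnj (\<xi> t))) \<le> q n * measure \<mu> (A n)"
      unfolding G_def by (rule q(2)[OF xi])
    from norm_triangle_mono[OF 1 this] show ?thesis
      unfolding eq by (simp add: distrib_right add.commute)
  qed
  then show ?case using lim by blast
next
  case (mid F H)
  then obtain q where q: "q \<longlonglongrightarrow> 0" "\<And>n x \<xi>. \<xi> \<in> dual_group \<Longrightarrow>
    norm ((LINT t:A n|\<mu>. F \<xi> (act t x) * cnj (\<xi> t)) - (LINT t:A n|\<mu>. f (act t x) * cnj (\<xi> t)))
      \<le> q n * measure \<mu> (A n)" by blast
  from mid obtain r where r: "r \<longlonglongrightarrow> 0" "\<And>n x \<xi>. \<xi> \<in> dual_group \<Longrightarrow>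
    norm ((LINT t:A n|\<mu>. H \<xi> (act t x) * cnj (\<xi> t)) - (LINT t:A n|\<mu>. f (act t x) * cnj (\<xi> t)))
      \<le> r n * measure \<mu> (A n)" by blast
  have A: "open (A n)" "compact (closure (A n))" for n
    using fol unfolding folner_sequence_def by auto
  have "(\<lambda>n. (q n + r n) / 2) \<longlonglongrightarrow> (0 + 0) / 2" by (intro tendsto_intros q r) simp
  then have lim: "(\<lambda>n. (q n + r n) / 2) \<longlonglongrightarrow> 0" by simp
  have "norm ((LINT t:A n|\<mu>. (F \<xi> (act t x) + H \<xi> (act t x)) / 2 * cnj (\<xi> t)) - (LINT t:A n|\<mu>. f (act t x) * cnj (\<xi> t)))
      \<le> (q n + r n) / 2 * measure \<mu> (A n)" if xi: "\<xi> \<in> dual_group" for n x \<xi>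
  proof -
    have cxi: "continuous_on UNIV \<xi>" and nxi: "norm (\<xi> t) = 1" for t
      using xi unfolding dual_group_def by auto
    have int: "set_integrable \<mu> (A n) (\<lambda>t. E \<xi> (act t x) * cnj (\<xi> t))" if E: "E \<in> twisted_averages act f" for E
    proof (rule haar_set_integrable[OF haar])
      have "continuous_on UNIV (\<lambda>t. E \<xi> (act t x))"
        using continuous_on_compose2[OF twisted_average_continuous[OF E act f] continuous_action_continuous(2)[OF act]] by simp
      then show "(\<lambda>t. E \<xi> (act t x) * cnj (\<xi> t)) \<in> borel_measurable borel"
        using cxi by (intro borel_measurable_continuous_onI continuous_intros)
      show "norm (E \<xi> (act t x) * cnj (\<xi> t)) \<le> b" for t
        using twisted_average_bounded[OF E b(1) xi] by (simp add: norm_mult nxi)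
    qed (use A haar_measure_translate(2)[OF haar A] in auto)
    define a c d where "a = (LINT t:A n|\<mu>. F \<xi> (act t x) * cnj (\<xi> t))"
      and "c = (LINT t:A n|\<mu>. H \<xi> (act t x) * cnj (\<xi> t))" and "d = (LINT t:A n|\<mu>. f (act t x) * cnj (\<xi> t))"
    have "(LINT t:A n|\<mu>. (F \<xi> (act t x) + H \<xi> (act t x)) / 2 * cnj (\<xi> t))
      = (LINT t:A n|\<mu>. (F \<xi> (act t x) * cnj (\<xi> t) + H \<xi> (act t x) * cnj (\<xi> t)) / 2)"
      by (simp add: add_divide_distrib distrib_right)
    also have "\<dots> = (a + c) / 2"
      unfolding a_def c_def using int mid.hyps by simp
    finally have eq: "(LINT t:A n|\<mu>. (F \<xi> (act t x) + H \<xi> (act t x)) / 2 * cnj (\<xi> t)) - d = ((a - d) + (c - d)) / 2"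
      by (simp add: field_simps)
    have "norm ((a - d) + (c - d)) \<le> q n * measure \<mu> (A n) + r n * measure \<mu> (A n)"
      unfolding a_def c_def d_def by (intro norm_triangle_mono q r xi)
    then show ?thesis unfolding d_def[symmetric] eq by (simp add: norm_divide distrib_right)
  qed
  then show ?case using lim by blast
qed

text \<open>
  Four errors of size \<open>e / 4\<close> add up: the \<open>L\<^sup>1\<close> norm of the twisted average \<open>F\<close> at \<open>\<xi>\<close>, the change of
  \<open>F\<close> when \<open>\<xi>\<close> is replaced by a nearby \<open>\<eta>\<close>, the deviation of orbit means of \<open>|F|\<close> from its
  integral, and the difference between the means of \<open>F\<close> and of \<open>f\<close>.
\<close>
lemma locally_uniform_Wiener_Wintner:
  fixes \<mu> :: "'g::{topological_ab_group_add, t2_space} measure"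
    and act :: "'g \<Rightarrow> 'x::topological_space \<Rightarrow> 'x"
  assumes haar: "haar_measure \<mu>" and fol: "folner_sequence \<mu> A"
    and comp: "compact (UNIV :: 'x set)" and metr: "metrizable_space (euclidean :: 'x topology)"
    and act: "continuous_action act" and ue: "uniquely_ergodic act" and inv: "invariant_prob act m"
    and f: "continuous_on UNIV f" and xi: "\<xi> \<in> dual_group" "\<xi> \<notin> eigenvalues act m" and "e > 0"
  shows "\<exists>U. openin dual_topology U \<and> \<xi> \<in> U \<and> (\<forall>\<^sub>F n in sequentially. \<forall>x. \<forall>\<eta>\<in>U.
    norm (LINT t:A n|\<mu>. f (act t x) * cnj (\<eta> t)) / measure \<mu> (A n) \<le> e)"
proof -
  obtain b where b: "b > 0" "\<And>x. norm (f x) \<le> b" using compact_continuous_bounded[OF comp f] by blast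
  have A: "open (A n)" "compact (closure (A n))" "measure \<mu> (A n) > 0" for n
    using fol unfolding folner_sequence_def by auto
  interpret m: prob_space m using inv unfolding invariant_prob_def by simp
  have sets_m[measurable_cong]: "sets m = sets borel" using inv unfolding invariant_prob_def by simp
  have sets_\<mu>: "sets \<mu> = sets borel" using haar unfolding haar_measure_def by simp
  have "\<exists>g\<in>(\<lambda>F. F \<xi>) ` twisted_averages act f. (LINT x|m. norm (g x)) < e / 4"
  proof (rule small_twisted_average_if_not_eigenvalue[OF inv _ xi])
    show "act t \<in> borel_measurable borel" for t
      by (intro borel_measurable_continuous_onI continuous_action_continuous(1)[OF act])
    show "(\<lambda>F. F \<xi>) ` twisted_averages act f \<noteq> {}" using twisted_averages.base by blast
    show meas: "g \<in> borel_measurable borel" if "g \<in> (\<lambda>F. F \<xi>) ` twisted_averages act f" for g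
      using that twisted_average_continuous[OF _ act f] by (auto intro: borel_measurable_continuous_onI)
    show "integrable m (\<lambda>x. (norm (g x))\<^sup>2)" if g: "g \<in> (\<lambda>F. F \<xi>) ` twisted_averages act f" for g
    proof (rule m.integrable_const_bound[where B = "b\<^sup>2"])
      show "AE x in m. norm ((norm (g x))\<^sup>2) \<le> b\<^sup>2"
        using g twisted_average_bounded[OF _ b(2) xi(1)] by (intro AE_I2) (auto intro!: power_mono)
      note meas[OF g, measurable]
      show "(\<lambda>x. (norm (g x))\<^sup>2) \<in> borel_measurable m" by measurable
    qed
    show "(\<lambda>x. (g x + h x) / 2) \<in> (\<lambda>F. F \<xi>) ` twisted_averages act f"
      if gh: "g \<in> (\<lambda>F. F \<xi>) ` twisted_averages act f" "h \<in> (\<lambda>F. F \<xi>) ` twisted_averages act f" for g h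
    proof -
      obtain F H where "F \<in> twisted_averages act f" "g = F \<xi>" "H \<in> twisted_averages act f" "h = H \<xi>"
        using gh by blast
      then show ?thesis by (intro image_eqI[OF _ twisted_averages.mid[of F act f H]]) auto
    qed
    show "(\<lambda>x. cnj (\<xi> t) * g (act t x)) \<in> (\<lambda>F. F \<xi>) ` twisted_averages act f"
      if g: "g \<in> (\<lambda>F. F \<xi>) ` twisted_averages act f" for g t
    proof -
      obtain F where "F \<in> twisted_averages act f" "g = F \<xi>" using g by blast
      then show ?thesis by (intro image_eqI[OF _ twisted_averages.twist[of F act f t]]) auto
    qed
    show "e / 4 > 0" using \<open>e > 0\<close> by simp
  qed
  then obtain F where F: "F \<in> twisted_averages act f" "(LINT x|m. norm (F \<xi> x)) < e / 4" by blast
  obtain U where U: "openin dual_topology U" "\<xi> \<in> U" "\<And>\<eta> x. \<eta> \<in> U \<Longrightarrow> norm (F \<eta> x - F \<xi> x) \<le> e / 4"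
    using twisted_average_equicontinuous[OF F(1) b(2,1) xi(1), of "e / 4"] \<open>e > 0\<close> by auto
  have Udual: "U \<subseteq> dual_group" using openin_subset[OF U(1)] unfolding topspace_dual_topology .
  obtain q where q: "q \<longlonglongrightarrow> 0" "\<And>n x \<eta>. \<eta> \<in> dual_group \<Longrightarrow>
    norm ((LINT t:A n|\<mu>. F \<eta> (act t x) * cnj (\<eta> t)) - (LINT t:A n|\<mu>. f (act t x) * cnj (\<eta> t)))
      \<le> q n * measure \<mu> (A n)"
    using twisted_average_same_mean[OF F(1) haar fol act f b(2,1)] by blast
  have cF: "continuous_on UNIV (F \<eta>)" for \<eta> by (rule twisted_average_continuous[OF F(1) act f])
  have ev1: "\<forall>\<^sub>F n in sequentially. \<forall>x. (LINT t:A n|\<mu>. norm (F \<xi> (act t x))) / measure \<mu> (A n)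
      \<le> (LINT x|m. norm (F \<xi> x)) + e / 4"
    using uniquely_ergodic_averages_le[OF haar fol comp metr act ue inv continuous_on_norm[OF cF], of "e / 4"]
      \<open>e > 0\<close> by simp
  have ev2: "\<forall>\<^sub>F n in sequentially. q n < e / 4" using q(1) \<open>e > 0\<close> by (intro order_tendstoD(2)) auto
  have "\<forall>\<^sub>F n in sequentially. \<forall>x. \<forall>\<eta>\<in>U.
    norm (LINT t:A n|\<mu>. f (act t x) * cnj (\<eta> t)) / measure \<mu> (A n) \<le> e"
    using ev1 ev2
  proof eventually_elim
    case (elim n)
    show ?case
    proof (intro allI ballI)
      fix x \<eta> assume \<eta>: "\<eta> \<in> U"
      then have \<eta>d: "\<eta> \<in> dual_group" using Udual by blast
      then have c\<eta>: "continuous_on UNIV \<eta>" and n\<eta>: "norm (\<eta> t) = 1" for t unfolding dual_group_def by auto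
      let ?a = "measure \<mu> (A n)"
      have a: "?a > 0" by (rule A)
      have cFx: "continuous_on UNIV (\<lambda>t. F \<zeta> (act t x))" for \<zeta>
        using continuous_on_compose2[OF cF continuous_action_continuous(2)[OF act]] by simp
      have fin: "emeasure \<mu> (A n) < \<infinity>" by (rule haar_measure_translate(2)[OF haar A(1,2)])
      have An: "A n \<in> sets borel" using A(1) by simp
      have i1: "set_integrable \<mu> (A n) (\<lambda>t. F \<eta> (act t x) * cnj (\<eta> t))"
        using cFx c\<eta> twisted_average_bounded[OF F(1) b(2) \<eta>d]
        by (intro haar_set_integrable[OF haar An fin, of _ b] borel_measurable_continuous_onI continuous_intros)
          (auto simp: norm_mult n\<eta>)
      have i2: "set_integrable \<mu> (A n) (\<lambda>t. norm (F \<xi> (act t x)))"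
        using cFx twisted_average_bounded[OF F(1) b(2) xi(1)]
        by (intro haar_set_integrable[OF haar An fin, of _ b] borel_measurable_continuous_onI continuous_intros) auto
      have i3: "set_integrable \<mu> (A n) (\<lambda>t. e / 4)"
        by (rule haar_set_integrable[OF haar An fin, of _ "\<bar>e / 4\<bar>"]) auto
      have "norm (LINT t:A n|\<mu>. F \<eta> (act t x) * cnj (\<eta> t)) \<le> (LINT t:A n|\<mu>. norm (F \<eta> (act t x) * cnj (\<eta> t)))"
        by (rule set_integral_norm_bound[OF i1])
      also have "\<dots> \<le> (LINT t:A n|\<mu>. norm (F \<xi> (act t x)) + e / 4)"
      proof (rule set_integral_mono)
        show "set_integrable \<mu> (A n) (\<lambda>t. norm (F \<eta> (act t x) * cnj (\<eta> t)))" by (rule set_integrable_norm[OF i1])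
        show "set_integrable \<mu> (A n) (\<lambda>t. norm (F \<xi> (act t x)) + e / 4)" by (rule set_integral_add(1)[OF i2 i3])
        show "norm (F \<eta> (act t x) * cnj (\<eta> t)) \<le> norm (F \<xi> (act t x)) + e / 4" for t
          using U(3)[OF \<eta>, of "act t x"] norm_triangle_sub[of "F \<eta> (act t x)" "F \<xi> (act t x)"]
          by (simp add: norm_mult n\<eta>)
      qed
      also have "\<dots> = (LINT t:A n|\<mu>. norm (F \<xi> (act t x))) + (LINT t:A n|\<mu>. e / 4)"
        by (rule set_integral_add(2)[OF i2 i3])
      also have "(LINT t:A n|\<mu>. e / 4) = e / 4 * ?a"
        using sets_eq_imp_space_eq[OF sets_\<mu>] unfolding set_lebesgue_integral_def by simp
      also have "(LINT t:A n|\<mu>. norm (F \<xi> (act t x))) \<le> (e / 4 + e / 4) * ?a"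
      proof -
        have "(LINT t:A n|\<mu>. norm (F \<xi> (act t x))) / ?a \<le> e / 4 + e / 4"
          using elim(1)[rule_format, of x] F(2) by linarith
        then show ?thesis using a by (simp only: pos_divide_le_eq)
      qed
      finally have 1: "norm (LINT t:A n|\<mu>. F \<eta> (act t x) * cnj (\<eta> t)) \<le> 3 * (e / 4) * ?a"
        by (simp add: algebra_simps)
      have 2: "q n * ?a \<le> e / 4 * ?a" using elim(2) a by (intro mult_right_mono) auto
      have "norm (LINT t:A n|\<mu>. f (act t x) * cnj (\<eta> t)) \<le> norm (LINT t:A n|\<mu>. F \<eta> (act t x) * cnj (\<eta> t))
        + norm ((LINT t:A n|\<mu>. F \<eta> (act t x) * cnj (\<eta> t)) - (LINT t:A n|\<mu>. f (act t x) * cnj (\<eta> t)))"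
        by (subst norm_minus_commute) (rule norm_triangle_sub)
      also have "\<dots> \<le> 3 * (e / 4) * ?a + e / 4 * ?a"
        using 1 2 q(2)[OF \<eta>d, of n x] by linarith
      finally show "norm (LINT t:A n|\<mu>. f (act t x) * cnj (\<eta> t)) / ?a \<le> e"
        using a by (simp add: pos_divide_le_eq algebra_simps)
    qed
  qed
  then show ?thesis using U by blast
qed

theorem corollary4p8:
  fixes \<mu> :: "'g::{topological_ab_group_add, t2_space} measure"
    and A :: "nat \<Rightarrow> 'g set"
    and act :: "'g \<Rightarrow> 'x::topological_space \<Rightarrow> 'x"
    and m :: "'x measure"
    and K :: "('g \<Rightarrow> complex) set"
    and f :: "'x \<Rightarrow> complex"
  assumes "sigma_compact_lca TYPE('g)"
    and "haar_measure \<mu>"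
    and "folner_sequence \<mu> A"
    and "compact (UNIV :: 'x set)"
    and "metrizable_space (euclidean :: 'x topology)"
    and "continuous_action act"
    and "uniquely_ergodic act"
    and "invariant_prob act m"
    and "compactin dual_topology K"
    and "K \<subseteq> dual_group - eigenvalues act m"
    and "continuous_on UNIV f"
  shows "(\<lambda>n. SUP x. SUP \<xi>\<in>K. ennreal (1 / measure \<mu> (A n) *
            norm (LINT t:A n|\<mu>. f (act t x) * cnj (\<xi> t)))) \<longlonglongrightarrow> 0"
proof (rule order_tendstoI)
  let ?a = "\<lambda>n x \<xi>. norm (LINT t:A n|\<mu>. f (act t x) * cnj (\<xi> t)) / measure \<mu> (A n)"
  fix c :: ennreal assume "c > 0"
  then obtain c' where c': "0 < c'" "c' < c" using dense by blast
  then obtain e where e: "c' = ennreal e" "e > 0" by (cases c') auto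
  have "\<forall>\<xi>\<in>K. \<exists>U. openin dual_topology U \<and> \<xi> \<in> U \<and> (\<forall>\<^sub>F n in sequentially. \<forall>x. \<forall>\<eta>\<in>U. ?a n x \<eta> \<le> e)"
  proof
    fix \<xi> assume "\<xi> \<in> K"
    then show "\<exists>U. openin dual_topology U \<and> \<xi> \<in> U \<and> (\<forall>\<^sub>F n in sequentially. \<forall>x. \<forall>\<eta>\<in>U. ?a n x \<eta> \<le> e)"
      using assms(10) by (intro locally_uniform_Wiener_Wintner[OF assms(2-8,11) _ _ e(2)]) auto
  qed
  from bchoice[OF this] obtain U where U: "\<And>\<xi>. \<xi> \<in> K \<Longrightarrow> openin dual_topology (U \<xi>)"
    "\<And>\<xi>. \<xi> \<in> K \<Longrightarrow> \<xi> \<in> U \<xi>"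
    "\<And>\<xi>. \<xi> \<in> K \<Longrightarrow> \<forall>\<^sub>F n in sequentially. \<forall>x. \<forall>\<eta>\<in>U \<xi>. ?a n x \<eta> \<le> e" by blast
  have "\<exists>\<F>. finite \<F> \<and> \<F> \<subseteq> U ` K \<and> K \<subseteq> \<Union>\<F>"
    using U(1,2) by (intro compactinD[OF assms(9)]) auto
  then obtain \<F> where \<F>: "finite \<F>" "\<F> \<subseteq> U ` K" and cover: "K \<subseteq> \<Union>\<F>" by blast
  then obtain K' where K': "K' \<subseteq> K" "finite K'" "\<F> = U ` K'"
    using finite_subset_image[OF \<F>] by blast
  have "\<forall>\<^sub>F n in sequentially. \<forall>\<xi>\<in>K'. \<forall>x. \<forall>\<eta>\<in>U \<xi>. ?a n x \<eta> \<le> e"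
    using K' U(3) by (intro eventually_ball_finite) auto
  then show "\<forall>\<^sub>F n in sequentially. (SUP x. SUP \<xi>\<in>K. ennreal (1 / measure \<mu> (A n) *
            norm (LINT t:A n|\<mu>. f (act t x) * cnj (\<xi> t)))) < c"
  proof eventually_elim
    case (elim n)
    have "(SUP x. SUP \<xi>\<in>K. ennreal (1 / measure \<mu> (A n) *
            norm (LINT t:A n|\<mu>. f (act t x) * cnj (\<xi> t)))) \<le> ennreal e"
    proof (intro SUP_least ennreal_leI)
      fix x \<xi> assume "\<xi> \<in> K"
      then have "?a n x \<xi> \<le> e" using elim K'(3) cover by blast
      then show "1 / measure \<mu> (A n) * norm (LINT t:A n|\<mu>. f (act t x) * cnj (\<xi> t)) \<le> e" by simp
    qed
    then show ?case using c' e by simp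
  qed
qed simp

end
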